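(* Let $\mathbf{x}_1,\ldots,\mathbf{x}_p\in\mathbb{R}^n$ be covariate vectors with $\|\mathbf{x}_j\|_2=n^{1/2}$, where $p=p_n$, and let $s=s_n$ be a positive integer less than half of the spark of the $n\times p$ matrix $(\mathbf{x}_1,\ldots,\mathbf{x}_p)$. Assume that any two distinct members of the collection $\mathcal{A}_s$ of all $\binom{p}{s}$ subspaces spanned by $s$ of the $\mathbf{x}_j$'s have maximum chordal distance at least a fixed constant $2\delta\in(0,1)$, and that $s/n\to\gamma\in(0,1/2)$ as $n\to\infty$. Assume in addition that any two disjoint subspaces in $\mathcal{A}_s$ have minimum principal angle at least a fixed constant $\arcsin\delta_1$ with $\delta_1\in(0,\delta]$. Then, as $n\to\infty$, $$\log(p-s)\lesssim\left[(\log\delta^{-1})(1-\gamma)-c_{\delta_1}-\gamma-2^{-1}\log(1-2\gamma)\right]n+2\log n+O(1),$$ where $$c_{\delta_1}=2^{-1}\left[\log(1-\delta_1^2)^{-1}\right](1-\gamma)-2^{-1}(1-\delta_1^2)^{-1}\delta_1^2(1-2\gamma).$$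
   Context: The spark $\kappa$ of an $n\times p$ matrix is the smallest positive integer $\kappa$ such that there is a singular $n\times\kappa$ submatrix, i.e. some $\kappa$ of its columns are linearly dependent. Since $s<\kappa/2$, every subspace spanned by $s$ of the $\mathbf{x}_j$'s is $s$-dimensional and different $s$-subsets span different subspaces, so $|\mathcal{A}_s|=\binom{p}{s}$. For two $s$-dimensional subspaces $V_1,V_2$ of $\mathbb{R}^n$ with principal angles $\pi/2\ge\theta_1\ge\cdots\ge\theta_s\ge0$, the maximum chordal distance is $d_m(V_1,V_2)=\sin\theta_1=\max_{1\le i\le s}\sin\theta_i$, and the minimum principal angle is $\theta_s$. Two subspaces in $\mathcal{A}_s$ are called disjoint if they are spanned by disjoint sets of $s$ of the covariates $\mathbf{x}_j$. $\lesssim$ denotes asymptotic dominance: $a_n\lesssim b_n$ means $a_n\le(1+o(1))\,b_n$ as $n\to\infty$. $O(1)$ denotes a bounded quantity as $n\to\infty$. *)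

theory Defs
  imports
    "Jordan_Normal_Form.DL_Rank_Submatrix"
    "HOL-Library.Landau_Symbols"
    "HOL-Library.Extended_Nat"
begin

text \<open>The dimension \<open>n\<close> of the ambient space varies, so a design matrix is a carrier-based
  real matrix; the covariates are its columns, indexed from 0.\<close>

text \<open>An \<open>n \<times> k\<close> submatrix is singular if its rank is less than \<open>k\<close>. Column index sets are used,
  so repeated columns count as linearly dependent. The value is \<open>\<infinity>\<close> if all columns
  together are linearly independent.\<close>

definition spark :: "real mat \<Rightarrow> enat" where
  "spark A = Inf {enat k | k J. 0 < k \<and> J \<subseteq> {..<dim_col A} \<and> card J = k \<and>
                               vec_space.rank (dim_row A) (submatrix A UNIV J) < k}"

definition col_span :: "real mat \<Rightarrow> nat set \<Rightarrow> real vec set" where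
  "col_span A J = vec_space.col_space (dim_row A) (submatrix A UNIV J)"

definition col_subspaces :: "real mat \<Rightarrow> nat \<Rightarrow> real vec set set" where
  "col_subspaces A s = {col_span A J | J. J \<subseteq> {..<dim_col A} \<and> card J = s}"

text \<open>Principal vectors: the pairs \<open>(v 0, w 0), \<dots>, (v (s - 1), w (s - 1))\<close> successively maximise
  the inner product over unit vectors of \<open>V\<close> and \<open>W\<close> that are orthogonal to the
  previously chosen ones.\<close>

definition principal_candidates ::
  "real vec set \<Rightarrow> real vec set \<Rightarrow> (nat \<Rightarrow> real vec) \<Rightarrow> (nat \<Rightarrow> real vec) \<Rightarrow> nat
    \<Rightarrow> (real vec \<times> real vec) set" where
  "principal_candidates V W v w k =
     {(x, y). x \<in> V \<and> y \<in> W \<and> x \<bullet> x = 1 \<and> y \<bullet> y = 1 \<and> (\<forall>j<k. x \<bullet> v j = 0 \<and> y \<bullet> w j = 0)}"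

definition principal_vectors ::
  "nat \<Rightarrow> real vec set \<Rightarrow> real vec set \<Rightarrow> (nat \<Rightarrow> real vec) \<Rightarrow> (nat \<Rightarrow> real vec) \<Rightarrow> bool" where
  "principal_vectors s V W v w \<longleftrightarrow>
     (\<forall>k<s. (v k, w k) \<in> principal_candidates V W v w k \<and>
            (\<forall>(x, y) \<in> principal_candidates V W v w k. x \<bullet> y \<le> v k \<bullet> w k))"

text \<open>The principal angles \<open>\<theta>\<^sub>1 \<ge> \<dots> \<ge> \<theta>\<^sub>s\<close> of two \<open>s\<close>-dimensional subspaces are numbered from
  the largest to the smallest, whereas principal vectors are chosen starting from the smallest
  angle, hence the index \<open>s - i\<close> for \<open>1 \<le> i \<le> s\<close>. The angles do not depend on the choice of the
  principal vectors.\<close>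

definition principal_angle :: "nat \<Rightarrow> real vec set \<Rightarrow> real vec set \<Rightarrow> nat \<Rightarrow> real" where
  "principal_angle s V W i =
     (let (v, w) = (SOME (v, w). principal_vectors s V W v w) in arccos (v (s - i) \<bullet> w (s - i)))"

definition max_chordal_dist :: "nat \<Rightarrow> real vec set \<Rightarrow> real vec set \<Rightarrow> real" where
  "max_chordal_dist s V W = sin (principal_angle s V W 1)"

definition min_principal_angle :: "nat \<Rightarrow> real vec set \<Rightarrow> real vec set \<Rightarrow> real" where
  "min_principal_angle s V W = principal_angle s V W s"

definition asymp_dominated :: "(nat \<Rightarrow> real) \<Rightarrow> (nat \<Rightarrow> real) \<Rightarrow> bool" (infix \<open>\<lesssim>\<close> 50) where
  "a \<lesssim> b \<longleftrightarrow> (\<exists>e \<in> o(\<lambda>_. 1). \<forall>\<^sub>F n in sequentially. a n \<le> (1 + e n) * b n)"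

definition c_const :: "real \<Rightarrow> real \<Rightarrow> real" where
  "c_const \<gamma> \<delta>\<^sub>1 = ln (1 / (1 - \<delta>\<^sub>1\<^sup>2)) / 2 * (1 - \<gamma>)
                   - 1 / 2 * (1 / (1 - \<delta>\<^sub>1\<^sup>2)) * \<delta>\<^sub>1\<^sup>2 * (1 - 2 * \<gamma>)"

end

theory Submission
  imports "HOL-Analysis.Ball_Volume" Defs
begin

text \<open>
  Fix \<open>s - 1\<close> of the covariates, spanning \<open>U\<close>. The subspaces spanned by \<open>U\<close> and one further
  covariate share \<open>U\<close>, so all but one of the principal angles between two of them vanish, and the
  largest one is the angle between the lines onto which the further covariates project in the
  orthogonal complement of \<open>U\<close>. The chordal distance condition thus provides \<open>p - s + 1\<close> lines in
  dimension \<open>d = n - s + 1\<close> with pairwise angles of sine at least \<open>2\<delta>\<close>, and a volume argument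
  limits their number to \<open>\<delta>\<close> to the power \<open>-d (1 + o(1))\<close>, i.e. the exponential rate is at most
  \<open>(1 - \<gamma>) ln (1 / \<delta>)\<close>. This is strictly below the claimed rate, because
  \<open>c_const \<gamma> \<delta>\<^sub>1 + \<gamma> + ln (1 - 2\<gamma>) / 2 < 0\<close>.
\<close>

unbundle no inner_syntax and no vec_syntax

section \<open>Packings of the sphere\<close>

text \<open>Invariance holds in each factor, and the product measure is determined by its values on
  boxes. Both signs matter: \<open>\<sigma> = 1\<close> gives translations,
  \<open>\<sigma> = -1\<close> point reflections.\<close>

lemma PiM_lborel_affine:
  fixes a :: "nat \<Rightarrow> real" and \<sigma> :: real
  assumes I: "finite I" and \<sigma>: "\<bar>\<sigma>\<bar> = 1"
    and A: "A \<in> sets (Pi\<^sub>M I (\<lambda>_. lborel))"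
  shows "emeasure (Pi\<^sub>M I (\<lambda>_. lborel)) ((\<lambda>x. \<lambda>i\<in>I. a i + \<sigma> * x i) -` A \<inter> space (Pi\<^sub>M I (\<lambda>_. lborel)))
       = emeasure (Pi\<^sub>M I (\<lambda>_. lborel)) A"
proof -
  interpret product_sigma_finite "\<lambda>_::nat. lborel :: real measure"
    by standard
  let ?M = "Pi\<^sub>M I (\<lambda>_. lborel) :: (nat \<Rightarrow> real) measure"
  let ?f = "\<lambda>x. \<lambda>i\<in>I. a i + \<sigma> * x i"
  have meas: "?f \<in> measurable ?M ?M"
    by (intro measurable_restrict) measurable
  have one: "emeasure lborel ((\<lambda>x. t + \<sigma> * x) -` B) = emeasure lborel B" if "B \<in> sets borel" for t B
  proof -
    have "lborel = distr lborel borel (\<lambda>x. t + \<sigma> * x)"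
      using lborel_real_affine[of \<sigma> t] \<sigma> by (auto simp: density_1)
    then have "emeasure lborel B = emeasure (distr lborel borel (\<lambda>x. t + \<sigma> * x)) B"
      by simp
    also have "\<dots> = emeasure lborel ((\<lambda>x. t + \<sigma> * x) -` B)"
      using that by (subst emeasure_distr) auto
    finally show ?thesis ..
  qed
  have "distr ?M ?M ?f = ?M"
  proof (rule PiM_eqI)
    fix B assume B: "\<And>i. i \<in> I \<Longrightarrow> B i \<in> sets (lborel :: real measure)"
    have pre: "?f -` Pi\<^sub>E I B \<inter> space ?M = Pi\<^sub>E I (\<lambda>i. (\<lambda>x. a i + \<sigma> * x) -` B i)"
      by (auto simp: space_PiM PiE_iff)
    have mB: "(\<lambda>x. a i + \<sigma> * x) -` B i \<in> sets lborel" if "i \<in> I" for i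
      using measurable_sets[of "\<lambda>x. a i + \<sigma> * x" borel borel "B i"] B[OF that] by simp
    have "emeasure (distr ?M ?M ?f) (Pi\<^sub>E I B) = emeasure ?M (Pi\<^sub>E I (\<lambda>i. (\<lambda>x. a i + \<sigma> * x) -` B i))"
      using meas B I by (subst emeasure_distr) (auto simp: pre intro!: sets_PiM_I_finite)
    also have "\<dots> = (\<Prod>i\<in>I. emeasure lborel ((\<lambda>x. a i + \<sigma> * x) -` B i))"
      using I mB by (intro emeasure_PiM) auto
    also have "\<dots> = (\<Prod>i\<in>I. emeasure lborel (B i))"
      using B one by (intro prod.cong) auto
    finally show "emeasure (distr ?M ?M ?f) (Pi\<^sub>E I B) = (\<Prod>i\<in>I. emeasure lborel (B i))" .
  qed (use I in auto)
  then have "emeasure ?M A = emeasure (distr ?M ?M ?f) A"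
    by simp
  also have "\<dots> = emeasure ?M (?f -` A \<inter> space ?M)"
    using meas A by (rule emeasure_distr)
  finally show ?thesis ..
qed

text \<open>The dimension is a variable, so volumes are taken on functions on a finite index set.
  Translation by \<open>a\<close> reduces the claim to the centred ball.\<close>

lemma emeasure_ball_PiM:
  fixes a :: "nat \<Rightarrow> real"
  assumes "finite I" "0 < \<rho>"
  shows "emeasure (Pi\<^sub>M I (\<lambda>_. lborel)) {x \<in> space (Pi\<^sub>M I (\<lambda>_. lborel)). (\<Sum>i\<in>I. (x i - a i)\<^sup>2) \<le> \<rho>\<^sup>2}
       = ennreal (unit_ball_vol (real (card I)) * \<rho> ^ card I)" (is "emeasure ?M ?B = _")
proof -
  have "emeasure ?M ?B = emeasure ?M ((\<lambda>x. \<lambda>i\<in>I. a i + 1 * x i) -` ?B \<inter> space ?M)"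
    using assms by (intro PiM_lborel_affine[symmetric]) auto
  also have "(\<lambda>x. \<lambda>i\<in>I. a i + 1 * x i) -` ?B \<inter> space ?M
      = {f. sqrt (\<Sum>i\<in>I. (f i)\<^sup>2) \<le> \<rho>} \<inter> space ?M"
    using assms by (auto simp: space_PiM real_sqrt_le_iff' sum_nonneg)
  finally show ?thesis
    using emeasure_cball_aux[OF assms] by simp
qed

section \<open>Disjoint cones and the volume bound for separated unit vectors\<close>

text \<open>Cones of half angle \<open>arcsin r\<close> about directions more than twice that angle
  apart meet only in the origin. A common \<open>x\<close> would have scalar product at least 2c
  times its length with \<open>y + z\<close>, whose squared length is below
  \<open>4 * c\<^sup>2\<close>, against Cauchy-Schwarz.\<close>

lemma inner_cone_less:
  fixes x y z :: "nat \<Rightarrow> real"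
  assumes y: "(\<Sum>i<d. (y i)\<^sup>2) = 1" and z: "(\<Sum>i<d. (z i)\<^sup>2) = 1"
    and yz: "(\<Sum>i<d. y i * z i) < 1 - 2 * r\<^sup>2"
    and c: "c\<^sup>2 + r\<^sup>2 = 1" "0 < c"
    and x: "c\<^sup>2 * (\<Sum>i<d. (x i)\<^sup>2) \<le> (\<Sum>i<d. x i * y i)\<^sup>2" "0 < (\<Sum>i<d. x i * y i)"
  shows "(\<Sum>i<d. x i * z i) \<le> 0 \<or> (\<Sum>i<d. x i * z i)\<^sup>2 < c\<^sup>2 * (\<Sum>i<d. (x i)\<^sup>2)"
proof (rule ccontr)
  define X where "X = (\<Sum>i<d. (x i)\<^sup>2)"
  define p where "p = (\<Sum>i<d. x i * y i)"
  define q where "q = (\<Sum>i<d. x i * z i)"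
  assume "\<not> ?thesis"
  then have q: "0 < q" "c\<^sup>2 * X \<le> q\<^sup>2"
    by (auto simp: q_def X_def)
  have p: "0 < p" "c\<^sup>2 * X \<le> p\<^sup>2"
    using x by (auto simp: p_def X_def)
  have "X \<noteq> 0"
  proof
    assume "X = 0"
    then have "\<forall>i<d. x i = 0"
      by (auto simp: X_def sum_nonneg_eq_0_iff)
    then show False
      using p(1) by (simp add: p_def)
  qed
  then have X: "0 < X"
    using sum_nonneg[of "{..<d}" "\<lambda>i. (x i)\<^sup>2"] by (simp add: X_def)
  have "c * sqrt X \<le> p" "c * sqrt X \<le> q"
    using p q X by (auto intro: power2_le_imp_le simp: power_mult_distrib)
  then have "2 * (c * sqrt X) \<le> p + q"
    by simp
  then have "(2 * (c * sqrt X))\<^sup>2 \<le> (p + q)\<^sup>2"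
    using c(2) X by (intro power_mono) auto
  then have 1: "4 * c\<^sup>2 * X \<le> (p + q)\<^sup>2"
    using X by (simp add: power_mult_distrib)
  have "p + q = (\<Sum>i<d. x i * (y i + z i))"
    by (simp add: p_def q_def sum.distrib algebra_simps)
  then have "(p + q)\<^sup>2 \<le> X * (\<Sum>i<d. (y i + z i)\<^sup>2)"
    using Cauchy_Schwarz_ineq_sum[of x "\<lambda>i. y i + z i" "{..<d}"] by (simp add: X_def)
  also have "(\<Sum>i<d. (y i + z i)\<^sup>2) = 2 + 2 * (\<Sum>i<d. y i * z i)"
    using y z by (simp add: power2_sum sum.distrib sum_distrib_left algebra_simps)
  also have "X * \<dots> < X * (4 * c\<^sup>2)"
    using X yz c(1) by (intro mult_strict_left_mono) auto
  finally show False
    using 1 by (simp add: algebra_simps)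
qed

text \<open>The disc of radius \<open>r\<close> about \<open>c * y j\<close> orthogonal to
  \<open>y j\<close> is the base of the spherical cap of half angle \<open>arcsin r\<close>. The
  half ball erected on it, away from the origin, lies in the cone over the cap, so different half
  balls are disjoint. Cutting them at height \<open>\<epsilon>\<close> costs little volume in high
  dimension and keeps them in a ball of radius close to 1.\<close>

lemma spherical_packing_bound:
  fixes y :: "'a \<Rightarrow> nat \<Rightarrow> real"
  assumes F: "finite F" and r: "0 < r" "r < 1" and \<epsilon>: "0 < \<epsilon>" "\<epsilon> < r"
    and unit: "\<And>j. j \<in> F \<Longrightarrow> (\<Sum>i<d. (y j i)\<^sup>2) = 1"
    and sep: "\<And>j k. j \<in> F \<Longrightarrow> k \<in> F \<Longrightarrow> j \<noteq> k \<Longrightarrow> (\<Sum>i<d. y j i * y k i) < 1 - 2 * r\<^sup>2"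
  shows "real (card F) * (r ^ d - 2 * sqrt (r\<^sup>2 - \<epsilon>\<^sup>2) ^ d) \<le> 2 * sqrt (1 + 2 * \<epsilon>) ^ d"
proof -
  define M where "M = (Pi\<^sub>M {..<d} (\<lambda>_. lborel) :: (nat \<Rightarrow> real) measure)"
  define v where "v = unit_ball_vol (real d)"
  define c where "c = sqrt (1 - r\<^sup>2)"
  define \<rho> where "\<rho> = sqrt (r\<^sup>2 - \<epsilon>\<^sup>2)"
  have r2: "r\<^sup>2 < 1"
    using r by (simp add: power_less_one_iff abs_square_less_1)
  then have c: "c\<^sup>2 + r\<^sup>2 = 1" "0 < c" "c \<le> 1"
    using r by (auto simp: c_def)
  have \<rho>: "0 < \<rho>" "\<rho>\<^sup>2 = r\<^sup>2 - \<epsilon>\<^sup>2"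
    using \<epsilon> by (auto simp: \<rho>_def power_strict_mono power_mono)
  have v: "0 < v"
    by (simp add: v_def)
  define B where "B = (\<lambda>(a :: nat \<Rightarrow> real) t. {x \<in> space M. (\<Sum>i<d. (x i - a i)\<^sup>2) \<le> t\<^sup>2})"
  \<comment> \<open>The sign \<open>\<sigma>\<close> selects the side of the hyperplane through
    \<open>a\<close> orthogonal to \<open>y j\<close>.\<close>
  define S where "S = (\<lambda>(a :: nat \<Rightarrow> real) (\<sigma> :: real) j. {x \<in> space M. (\<Sum>i<d. (x i - a i)\<^sup>2) \<le> r\<^sup>2 \<and>
     0 \<le> \<sigma> * (\<Sum>i<d. (x i - a i) * y j i) \<and> \<sigma> * (\<Sum>i<d. (x i - a i) * y j i) \<le> \<epsilon>})"
  have B_sets: "B a t \<in> sets M" and S_sets: "S a \<sigma> j \<in> sets M" for a t \<sigma> j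
    unfolding B_def S_def M_def by measurable
  have vol_B: "emeasure M (B a t) = ennreal (v * t ^ d)" if "0 < t" for a t
    using emeasure_ball_PiM[of "{..<d}" t a] that by (simp add: M_def B_def v_def)
  have S_move: "emeasure M (S a \<sigma> j) = emeasure M (S (\<lambda>_. 0) 1 j)" if "\<bar>\<sigma>\<bar> = 1" for a \<sigma> j
  proof -
    have \<sigma>: "\<sigma> * \<sigma> = 1"
      using that by (metis abs_mult_self_eq mult.left_neutral)
    have "(\<lambda>x. \<lambda>i\<in>{..<d}. a i + \<sigma> * x i) -` S a \<sigma> j \<inter> space M = S (\<lambda>_. 0) 1 j"
    proof -
      have "(\<Sum>i<d. (\<sigma> * x i)\<^sup>2) = (\<Sum>i<d. (x i)\<^sup>2)" for x :: "nat \<Rightarrow> real"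
        using \<sigma> by (simp add: power_mult_distrib power2_eq_square[of \<sigma>])
      moreover have "\<sigma> * (\<Sum>i<d. \<sigma> * x i * y j i) = (\<Sum>i<d. x i * y j i)" for x :: "nat \<Rightarrow> real"
        using \<sigma> by (simp add: sum_distrib_left mult.assoc[symmetric])
      ultimately show ?thesis
        by (auto simp: S_def M_def space_PiM)
    qed
    then show ?thesis
      using PiM_lborel_affine[of "{..<d}" \<sigma> "S a \<sigma> j" a] that S_sets by (simp add: M_def)
  qed
  \<comment> \<open>Outside the slab of width \<open>\<epsilon>\<close> the ball is covered by two balls of the smaller radius \<open>\<rho>\<close>,
    whose volume is negligible in high dimension.\<close>
  have cover: "B (\<lambda>_. 0) r \<subseteq> (S (\<lambda>_. 0) 1 j \<union> S (\<lambda>_. 0) (-1) j) \<union>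
      (B (\<lambda>i. \<epsilon> * y j i) \<rho> \<union> B (\<lambda>i. - \<epsilon> * y j i) \<rho>)" if j: "j \<in> F" for j
  proof
    fix x assume x: "x \<in> B (\<lambda>_. 0) r"
    define t where "t = (\<Sum>i<d. x i * y j i)"
    have eq: "(\<Sum>i<d. (x i - e * y j i)\<^sup>2) = (\<Sum>i<d. (x i)\<^sup>2) - 2 * e * t + e\<^sup>2" for e
    proof -
      have "(\<Sum>i<d. (x i - e * y j i)\<^sup>2) = (\<Sum>i<d. (x i)\<^sup>2) - 2 * e * t + e\<^sup>2 * (\<Sum>i<d. (y j i)\<^sup>2)"
        by (simp add: power2_diff sum.distrib sum_subtractf sum_distrib_left power_mult_distrib t_def algebra_simps)
      then show ?thesis
        using unit[OF j] by simp
    qed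
    \<comment> \<open>Beyond the slab, moving the centre by \<open>\<epsilon>\<close> towards the
      side of \<open>x\<close> lowers the squared distance to at most
      \<open>r\<^sup>2 - \<epsilon>\<^sup>2\<close>, the square of \<open>\<rho>\<close>.\<close>
    have "\<epsilon> * \<epsilon> \<le> \<epsilon> * t" if "t > \<epsilon>"
      using that \<epsilon> by simp
    moreover have "\<epsilon> * \<epsilon> \<le> \<epsilon> * (-t)" if "t < - \<epsilon>"
      using that \<epsilon> by (intro mult_left_mono) auto
    ultimately show "x \<in> (S (\<lambda>_. 0) 1 j \<union> S (\<lambda>_. 0) (-1) j) \<union>
      (B (\<lambda>i. \<epsilon> * y j i) \<rho> \<union> B (\<lambda>i. - \<epsilon> * y j i) \<rho>)"
      using x eq[of \<epsilon>] eq[of "-\<epsilon>"] \<rho>(2)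
      by (auto simp: S_def B_def t_def[symmetric] power2_eq_square not_le)
  qed
  have S_vol: "v * (r ^ d - 2 * \<rho> ^ d) / 2 \<le> measure M (S a 1 j)" and S_fin: "emeasure M (S a 1 j) \<noteq> \<infinity>"
    if j: "j \<in> F" for a j
  proof -
    have "emeasure M (S a 1 j) \<le> emeasure M (B a r)"
      by (intro emeasure_mono B_sets) (auto simp: S_def B_def)
    then show fin: "emeasure M (S a 1 j) \<noteq> \<infinity>"
      using vol_B[OF r(1), of a] by (auto simp: top_unique)
    define m where "m = measure M (S a 1 j)"
    have m: "emeasure M (S a 1 j) = ennreal m" "0 \<le> m"
      using fin by (auto simp: m_def emeasure_eq_ennreal_measure)
    have m': "emeasure M (S (\<lambda>_. 0) 1 j) = ennreal m" "emeasure M (S (\<lambda>_. 0) (-1) j) = ennreal m"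
      using S_move[of 1 a j] S_move[of "-1" "\<lambda>_. 0" j] m by auto
    \<comment> \<open>By symmetry both half slabs have volume \<open>m\<close>, so the covering
      leaves a lower bound for \<open>2 * m\<close>.\<close>
    have "ennreal (v * r ^ d) = emeasure M (B (\<lambda>_. 0) r)"
      using vol_B r by simp
    also have "\<dots> \<le> emeasure M ((S (\<lambda>_. 0) 1 j \<union> S (\<lambda>_. 0) (-1) j) \<union>
      (B (\<lambda>i. \<epsilon> * y j i) \<rho> \<union> B (\<lambda>i. - \<epsilon> * y j i) \<rho>))"
      using cover[OF j] B_sets S_sets by (intro emeasure_mono) auto
    also have "\<dots> \<le> (emeasure M (S (\<lambda>_. 0) 1 j) + emeasure M (S (\<lambda>_. 0) (-1) j)) +
        (emeasure M (B (\<lambda>i. \<epsilon> * y j i) \<rho>) + emeasure M (B (\<lambda>i. - \<epsilon> * y j i) \<rho>))"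
      using B_sets S_sets
      by (intro order_trans[OF emeasure_subadditive] add_mono emeasure_subadditive) auto
    also have "\<dots> = ennreal (2 * m + 2 * (v * \<rho> ^ d))"
      using m m' \<rho> v by (simp add: vol_B ennreal_plus[symmetric] del: ennreal_plus)
    finally have "v * r ^ d \<le> 2 * m + 2 * (v * \<rho> ^ d)"
      using m v \<rho> by (subst (asm) ennreal_le_iff) auto
    then show "v * (r ^ d - 2 * \<rho> ^ d) / 2 \<le> measure M (S a 1 j)"
      by (simp add: m_def algebra_simps)
  qed
  \<comment> \<open>The half slabs lie in cones around the \<open>y j\<close> whose opening is too small for them to meet.\<close>
  define K where "K = (\<lambda>j. S (\<lambda>i. c * y j i) 1 j)"
  have K_cone: "c\<^sup>2 * (\<Sum>i<d. (x i)\<^sup>2) \<le> (\<Sum>i<d. x i * y j i)\<^sup>2" "0 < (\<Sum>i<d. x i * y j i)"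
      "(\<Sum>i<d. (x i)\<^sup>2) \<le> 1 + 2 * \<epsilon>"
    if x: "x \<in> K j" and j: "j \<in> F" for x j
  proof -
    \<comment> \<open>The height of \<open>x\<close> above the base of the cap. All three claims
      follow from \<open>0 \<le> t \<le> \<epsilon>\<close>, the ball condition and
      \<open>c\<^sup>2 + r\<^sup>2 = 1\<close>, the scalar product with \<open>y j\<close> being
      \<open>c + t\<close>.\<close>
    define t where "t = (\<Sum>i<d. (x i - c * y j i) * y j i)"
    have t: "0 \<le> t" "t \<le> \<epsilon>" and b: "(\<Sum>i<d. (x i - c * y j i)\<^sup>2) \<le> r\<^sup>2"
      using x by (auto simp: K_def S_def t_def)
    have "t = (\<Sum>i<d. x i * y j i) - c * (\<Sum>i<d. (y j i)\<^sup>2)"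
      by (simp add: t_def sum_subtractf sum_distrib_left power2_eq_square algebra_simps)
    then have xy: "(\<Sum>i<d. x i * y j i) = c + t"
      using unit[OF j] by simp
    have "(\<Sum>i<d. (x i - c * y j i)\<^sup>2) = (\<Sum>i<d. (x i)\<^sup>2) - 2 * c * (\<Sum>i<d. x i * y j i) + c\<^sup>2 * (\<Sum>i<d. (y j i)\<^sup>2)"
      by (simp add: power2_diff sum.distrib sum_subtractf sum_distrib_left power_mult_distrib algebra_simps)
    then have xx: "(\<Sum>i<d. (x i)\<^sup>2) \<le> 1 + 2 * (c * t)"
      using b c(1) unit[OF j] by (simp add: xy power2_eq_square algebra_simps)
    have ct: "c * t \<le> t"
      using c t by (simp add: mult_left_le_one_le)
    show "(\<Sum>i<d. (x i)\<^sup>2) \<le> 1 + 2 * \<epsilon>"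
      using xx ct t by simp
    show "0 < (\<Sum>i<d. x i * y j i)"
      using xy c t by simp
    have "c\<^sup>2 * (\<Sum>i<d. (x i)\<^sup>2) \<le> c\<^sup>2 * (1 + 2 * (c * t))"
      using xx by (intro mult_left_mono) auto
    also have "\<dots> \<le> (c + t)\<^sup>2"
    proof -
      have "c\<^sup>2 * (c * t) \<le> 1 * (c * t)"
        using c t by (intro mult_right_mono) (auto simp: power_le_one)
      moreover have "c\<^sup>2 * (1 + 2 * (c * t)) = c\<^sup>2 + 2 * (c\<^sup>2 * (c * t))"
        by (simp add: algebra_simps)
      moreover have "(c + t)\<^sup>2 = c\<^sup>2 + 2 * (c * t) + t\<^sup>2"
        by (simp add: power2_sum)
      ultimately show ?thesis
        using zero_le_power2[of t] by linarith
    qed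
    finally show "c\<^sup>2 * (\<Sum>i<d. (x i)\<^sup>2) \<le> (\<Sum>i<d. x i * y j i)\<^sup>2"
      by (simp add: xy)
  qed
  have disj: "disjoint_family_on K F"
    unfolding disjoint_family_on_def
  proof (intro ballI impI, rule ccontr)
    fix j k assume jk: "j \<in> F" "k \<in> F" "j \<noteq> k" and "K j \<inter> K k \<noteq> {}"
    then obtain x where x: "x \<in> K j" "x \<in> K k"
      by auto
    show False
      using inner_cone_less[OF unit[OF jk(1)] unit[OF jk(2)] sep[OF jk] c(1,2) K_cone(1,2)[OF x(1) jk(1)]]
        K_cone(1,2)[OF x(2) jk(2)] by simp
  qed
  have "(\<Sum>j\<in>F. ennreal (measure M (K j))) = (\<Sum>j\<in>F. emeasure M (K j))"
    using S_fin by (intro sum.cong) (auto simp: K_def emeasure_eq_ennreal_measure)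
  also have "\<dots> = emeasure M (\<Union>j\<in>F. K j)"
    using disj F S_sets by (intro sum_emeasure) (auto simp: K_def)
  also have "\<dots> \<le> emeasure M (B (\<lambda>_. 0) (sqrt (1 + 2 * \<epsilon>)))"
  proof (intro emeasure_mono B_sets subsetI)
    fix x assume "x \<in> (\<Union>j\<in>F. K j)"
    then show "x \<in> B (\<lambda>_. 0) (sqrt (1 + 2 * \<epsilon>))"
      using K_cone(3) \<epsilon> by (auto simp: B_def K_def S_def)
  qed
  also have "\<dots> = ennreal (v * sqrt (1 + 2 * \<epsilon>) ^ d)"
    using \<epsilon> by (intro vol_B) auto
  finally have "(\<Sum>j\<in>F. measure M (K j)) \<le> v * sqrt (1 + 2 * \<epsilon>) ^ d"
    using v \<epsilon> by (subst (asm) sum_ennreal) (auto simp: ennreal_le_iff)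
  moreover have "(\<Sum>j\<in>F. v * (r ^ d - 2 * \<rho> ^ d) / 2) \<le> (\<Sum>j\<in>F. measure M (K j))"
    unfolding K_def by (intro sum_mono S_vol)
  ultimately have "v * (real (card F) * (r ^ d - 2 * \<rho> ^ d)) \<le> v * (2 * sqrt (1 + 2 * \<epsilon>) ^ d)"
    by (simp add: algebra_simps)
  then show ?thesis
    using v by (simp add: \<rho>_def)
qed

section \<open>Orthonormal frames\<close>

lemma scalar_prod_eq_sum: "w \<in> carrier_vec n \<Longrightarrow> v \<bullet> w = (\<Sum>i<n. v $ i * w $ i)"
  by (auto simp: scalar_prod_def atLeast0LessThan)

lemma real_scalar_prod_commute: "v \<in> carrier_vec n \<Longrightarrow> w \<in> carrier_vec n \<Longrightarrow> v \<bullet> w = w \<bullet> (v :: real vec)"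
  by (simp add: scalar_prod_eq_sum mult.commute)

lemma real_scalar_prod_self_eq_0:
  fixes v :: "real vec"
  assumes "v \<in> carrier_vec n" "v \<bullet> v = 0"
  shows "v = 0\<^sub>v n"
  using assms by (auto simp: scalar_prod_eq_sum sum_nonneg_eq_0_iff intro!: eq_vecI)

lemma unit_scalar_prod_le_1:
  fixes x y :: "real vec"
  assumes "x \<in> carrier_vec n" "y \<in> carrier_vec n" "x \<bullet> x = 1" "y \<bullet> y = 1"
  shows "\<bar>x \<bullet> y\<bar> \<le> 1"
proof -
  have "0 \<le> (\<Sum>i<n. (x $ i + t * y $ i)\<^sup>2)" for t
    by (intro sum_nonneg) auto
  also have "(\<Sum>i<n. (x $ i + t * y $ i)\<^sup>2) = x \<bullet> x + 2 * t * (x \<bullet> y) + t\<^sup>2 * (y \<bullet> y)" for t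
    using assms(1,2)
    by (simp add: scalar_prod_eq_sum power2_eq_square algebra_simps sum.distrib sum_distrib_left)
  finally have "0 \<le> 1 + 2 * t * (x \<bullet> y) + t\<^sup>2" for t
    using assms by simp
  from this[of 1] this[of "-1"] show ?thesis
    by simp
qed

lemma unit_scalar_prod_eq_1:
  fixes x y :: "real vec"
  assumes "x \<in> carrier_vec n" "y \<in> carrier_vec n" "x \<bullet> x = 1" "y \<bullet> y = 1" "x \<bullet> y = 1"
  shows "x = y"
proof -
  have "(\<Sum>i<n. (x $ i - y $ i)\<^sup>2) = x \<bullet> x - 2 * (x \<bullet> y) + y \<bullet> y"
    using assms(1,2)
    by (simp add: scalar_prod_eq_sum power2_eq_square algebra_simps sum.distrib sum_subtractf sum_distrib_left)
  then have "\<forall>i<n. x $ i = y $ i"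
    using assms by (auto simp: sum_nonneg_eq_0_iff)
  then show ?thesis
    using assms(1,2) by (auto intro!: eq_vecI)
qed

text \<open>The system is padded to a square matrix whose row \<open>m\<close> is zero, so its
  determinant vanishes; the rows after \<open>m\<close> only add equations.\<close>

lemma homogeneous_system_nontrivial_solution:
  fixes a :: "nat \<Rightarrow> nat \<Rightarrow> real"
  assumes "m < n"
  obtains x where "\<exists>i<n. x i \<noteq> 0" "\<And>j. j < m \<Longrightarrow> (\<Sum>i<n. a j i * x i) = 0"
proof -
  define A where "A = mat\<^sub>r n n (\<lambda>j. if j = m then 0\<^sub>v n else vec n (a j))"
  have A: "A \<in> carrier_mat n n"
    by (simp add: A_def)
  moreover have "det A = 0"
    unfolding A_def by (intro det_row_0 assms) auto
  ultimately obtain v where v: "v \<in> carrier_vec n" "v \<noteq> 0\<^sub>v n" "A *\<^sub>v v = 0\<^sub>v n"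
    using det_0_iff_vec_prod_zero by blast
  show thesis
  proof
    show "\<exists>i<n. v $ i \<noteq> 0"
    proof (rule ccontr)
      assume "\<not> ?thesis"
      then have "v = 0\<^sub>v n"
        using v(1) by (intro eq_vecI) auto
      then show False
        using v(2) by simp
    qed
    fix j assume j: "j < m"
    then have "row A j = vec n (a j)"
      using assms by (simp add: A_def)
    then have "(A *\<^sub>v v) $ j = (\<Sum>i<n. a j i * v $ i)"
      using j assms A by (simp add: scalar_prod_eq_sum[OF v(1)])
    then show "(\<Sum>i<n. a j i * v $ i) = 0"
      using v(3) j assms by simp
  qed
qed

lemma exists_unit_orthogonal:
  fixes a :: "nat \<Rightarrow> real vec"
  assumes "m < n" and a: "\<And>j. j < m \<Longrightarrow> a j \<in> carrier_vec n"
  obtains u where "u \<in> carrier_vec n" "u \<bullet> u = 1" "\<And>j. j < m \<Longrightarrow> a j \<bullet> u = 0"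
proof -
  obtain x where x: "\<exists>i<n. x i \<noteq> 0" "\<And>j. j < m \<Longrightarrow> (\<Sum>i<n. a j $ i * x i) = 0"
    by (rule homogeneous_system_nontrivial_solution[OF assms(1), where a = "\<lambda>j i. a j $ i"]) blast
  define N where "N = (\<Sum>i<n. (x i)\<^sup>2)"
  have "N \<noteq> 0"
    using x(1) by (auto simp: N_def sum_nonneg_eq_0_iff)
  then have N: "0 < N"
    using sum_nonneg[of "{..<n}" "\<lambda>i. (x i)\<^sup>2"] by (simp add: N_def)
  define u where "u = vec n (\<lambda>i. x i / sqrt N)"
  show thesis
  proof
    show u: "u \<in> carrier_vec n"
      by (simp add: u_def)
    have "u \<bullet> u = (\<Sum>i<n. (x i)\<^sup>2 / N)"
      unfolding scalar_prod_eq_sum[OF u] using N by (intro sum.cong) (auto simp: u_def power2_eq_square)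
    then show "u \<bullet> u = 1"
      using N by (simp add: N_def flip: sum_divide_distrib)
    fix j assume j: "j < m"
    have "a j \<bullet> u = (\<Sum>i<n. a j $ i * x i / sqrt N)"
      unfolding scalar_prod_eq_sum[OF u] by (intro sum.cong) (auto simp: u_def)
    then show "a j \<bullet> u = 0"
      using x(2)[OF j] by (simp flip: sum_divide_distrib)
  qed
qed

definition orthonormal :: "nat \<Rightarrow> nat \<Rightarrow> (nat \<Rightarrow> real vec) \<Rightarrow> bool" where
  "orthonormal n m e \<longleftrightarrow>
     (\<forall>i<m. e i \<in> carrier_vec n) \<and> (\<forall>i<m. \<forall>j<m. e i \<bullet> e j = (if i = j then 1 else 0))"

text \<open>Each new vector has to satisfy fewer than \<open>n\<close> orthogonality conditions:
  against the \<open>k\<close> vectors \<open>f j\<close> and against the vectors already present.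
  Positive \<open>k\<close> serves to build a basis of an orthogonal complement,
  \<open>k = 0\<close> to complete it to a full frame.\<close>

lemma orthonormal_extend:
  assumes f: "\<And>j. j < k \<Longrightarrow> f j \<in> carrier_vec n" and e: "orthonormal n m e"
    and "m \<le> m'" "m' + k \<le> n"
  obtains e' where "\<And>i. i < m \<Longrightarrow> e' i = e i" "orthonormal n m' e'"
    "\<And>i j. j < k \<Longrightarrow> m \<le> i \<Longrightarrow> i < m' \<Longrightarrow> f j \<bullet> e' i = 0"
proof -
  have "\<exists>e'. (\<forall>i<m. e' i = e i) \<and> orthonormal n m' e' \<and>
      (\<forall>j<k. \<forall>i. m \<le> i \<and> i < m' \<longrightarrow> f j \<bullet> e' i = 0)"
    using assms(3,4)
  proof (induction m' rule: dec_induct)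
    case base
    then show ?case
      using e by auto
  next
    case (step l)
    then obtain e' where e': "\<forall>i<m. e' i = e i" "orthonormal n l e'"
        "\<forall>j<k. \<forall>i. m \<le> i \<and> i < l \<longrightarrow> f j \<bullet> e' i = 0"
      by auto
    have "k + l < n"
      using step by simp
    moreover have "(if j < k then f j else e' (j - k)) \<in> carrier_vec n" if "j < k + l" for j
      using that f e'(2) by (auto simp: orthonormal_def)
    ultimately obtain u where u: "u \<in> carrier_vec n" "u \<bullet> u = 1"
        "\<And>j. j < k + l \<Longrightarrow> (if j < k then f j else e' (j - k)) \<bullet> u = 0"
      using exists_unit_orthogonal[of "k + l" n "\<lambda>j. if j < k then f j else e' (j - k)"] by metis
    have fu: "f j \<bullet> u = 0" if "j < k" for j
      using u(3)[of j] that by simp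
    have eu: "e' i \<bullet> u = 0" if "i < l" for i
      using u(3)[of "k + i"] that by simp
    have ue: "u \<bullet> e' i = 0" if "i < l" for i
      using eu[OF that] real_scalar_prod_commute[OF u(1), of "e' i"] e'(2) that
      by (simp add: orthonormal_def)
    have "orthonormal n (Suc l) (e'(l := u))"
      using e'(2) u(1,2) eu ue by (auto simp: orthonormal_def less_Suc_eq)
    moreover have "\<forall>i<m. (e'(l := u)) i = e i"
      using e'(1) step(1) by auto
    moreover have "\<forall>j<k. \<forall>i. m \<le> i \<and> i < Suc l \<longrightarrow> f j \<bullet> (e'(l := u)) i = 0"
      using e'(3) fu by (auto simp: less_Suc_eq)
    ultimately show ?case
      by blast
  qed
  then show thesis
    using that by blast
qed

text \<open>The square matrix \<open>E\<close> with rows \<open>e i\<close> has its transpose as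
  right inverse, hence also as left inverse, so \<open>E\<close> preserves scalar products.\<close>

lemma orthonormal_parseval:
  assumes e: "orthonormal n n e" and y: "y \<in> carrier_vec n" and z: "z \<in> carrier_vec n"
  shows "y \<bullet> z = (\<Sum>m<n. (y \<bullet> e m) * (z \<bullet> e m))"
proof -
  define E where "E = mat n n (\<lambda>(i, j). e i $ j)"
  have E: "E \<in> carrier_mat n n"
    by (simp add: E_def)
  have ec: "e i \<in> carrier_vec n" if "i < n" for i
    using e that by (auto simp: orthonormal_def)
  have row: "row E i = e i" if "i < n" for i
    using ec[OF that] that by (auto simp: E_def intro!: eq_vecI)
  have "E * transpose_mat E = 1\<^sub>m n"
    using e E by (auto simp: row orthonormal_def intro!: eq_matI)
  then have EE: "transpose_mat E * E = 1\<^sub>m n"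
    using E mat_mult_left_right_inverse[of E n "transpose_mat E"] by simp
  have "y \<bullet> z = ((transpose_mat E * E) *\<^sub>v y) \<bullet> z"
    using y by (simp add: EE)
  also have "\<dots> = (transpose_mat E *\<^sub>v (E *\<^sub>v y)) \<bullet> z"
    using E y by simp
  also have "\<dots> = (E *\<^sub>v y) \<bullet> (E *\<^sub>v z)"
    using E z y by (intro transpose_vec_mult_scalar mult_mat_vec_carrier)
  also have "\<dots> = (\<Sum>m<n. (e m \<bullet> y) * (e m \<bullet> z))"
    using E mult_mat_vec_carrier[OF E z] by (subst scalar_prod_eq_sum[of _ n]) (auto simp: row intro!: sum.cong)
  also have "\<dots> = (\<Sum>m<n. (y \<bullet> e m) * (z \<bullet> e m))"
    using ec real_scalar_prod_commute[of _ n] y z by (intro sum.cong) auto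
  finally show ?thesis .
qed

text \<open>Coefficients are indexed by the elements of \<open>J\<close> themselves, so that
  combinations over different index sets are compared without renumbering.\<close>

definition lin_comb :: "nat \<Rightarrow> 'i set \<Rightarrow> ('i \<Rightarrow> real vec) \<Rightarrow> ('i \<Rightarrow> real) \<Rightarrow> real vec" where
  "lin_comb n J f c = vec n (\<lambda>r. \<Sum>j\<in>J. c j * f j $ r)"

lemma lin_comb_carrier [simp]: "lin_comb n J f c \<in> carrier_vec n"
  by (simp add: lin_comb_def)

lemma lin_comb_scalar_prod:
  assumes "z \<in> carrier_vec n"
  shows "lin_comb n J f c \<bullet> z = (\<Sum>j\<in>J. c j * (f j \<bullet> z))"
proof -
  have "lin_comb n J f c \<bullet> z = (\<Sum>i<n. \<Sum>j\<in>J. c j * (f j $ i * z $ i))"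
    using assms by (simp add: scalar_prod_eq_sum lin_comb_def sum_distrib_right mult.assoc)
  also have "\<dots> = (\<Sum>j\<in>J. c j * (f j \<bullet> z))"
    using assms by (subst sum.swap) (simp add: scalar_prod_eq_sum sum_distrib_left)
  finally show ?thesis .
qed

text \<open>The first \<open>n - k\<close> frame vectors form a basis of the orthogonal complement
  of the span, so membership in the span becomes the vanishing of \<open>n - k\<close>
  coordinates.\<close>

lemma exists_frame_adapted_to_span:
  fixes f :: "nat \<Rightarrow> real vec"
  assumes f: "\<And>j. j < k \<Longrightarrow> f j \<in> carrier_vec n" and k: "k \<le> n"
    and indep: "\<And>c j. lin_comb n {..<k} f c = 0\<^sub>v n \<Longrightarrow> j < k \<Longrightarrow> c j = 0"
  obtains e where "orthonormal n n e"
    "\<And>y. y \<in> carrier_vec n \<Longrightarrow> (\<forall>m<n-k. y \<bullet> e m = 0) \<longleftrightarrow> (\<exists>c. y = lin_comb n {..<k} f c)"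
proof -
  have e0: "orthonormal n 0 (\<lambda>_. 0\<^sub>v n)"
    by (simp add: orthonormal_def)
  obtain e' where e': "orthonormal n (n - k) e'" "\<And>i j. j < k \<Longrightarrow> 0 \<le> i \<Longrightarrow> i < n - k \<Longrightarrow> f j \<bullet> e' i = 0"
    by (rule orthonormal_extend[where m' = "n - k", OF f e0]) (use k in auto)
  obtain e where e: "\<And>i. i < n - k \<Longrightarrow> e i = e' i" "orthonormal n n e"
    by (rule orthonormal_extend[where k = 0 and m' = n and f = f, OF _ e'(1)]) auto
  have fe: "f j \<bullet> e i = 0" if "j < k" "i < n - k" for i j
    using e'(2) e(1) that by simp
  have ec: "e i \<in> carrier_vec n" if "i < n" for i
    using e(2) that by (auto simp: orthonormal_def)
  have "\<exists>c. y = lin_comb n {..<k} f c" if y: "y \<in> carrier_vec n" and ye: "\<forall>m<n-k. y \<bullet> e m = 0" for y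
  proof -
    \<comment> \<open>The \<open>k + 1\<close> vectors \<open>f 0, \<dots>, f (k - 1), y\<close> live in a space with \<open>k\<close> coordinates.\<close>
    define g where "g = f(k := y)"
    obtain x where x: "\<exists>i<Suc k. x i \<noteq> 0"
        "\<And>j. j < k \<Longrightarrow> (\<Sum>i<Suc k. (g i \<bullet> e (n - k + j)) * x i) = 0"
      using homogeneous_system_nontrivial_solution[of k "Suc k" "\<lambda>j i. g i \<bullet> e (n - k + j)"] by auto
    define z where "z = lin_comb n {..<Suc k} g x"
    have "z \<bullet> e m = 0" if m: "m < n" for m
    proof (cases "m < n - k")
      case True
      then show ?thesis
        using ye fe by (simp add: z_def lin_comb_scalar_prod[OF ec[OF m]] g_def)
    next
      case False
      then show ?thesis
        using x(2)[of "m - (n - k)"] m k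
        by (simp add: z_def lin_comb_scalar_prod[OF ec[OF m]] mult.commute)
    qed
    then have "z \<bullet> z = 0"
      by (subst orthonormal_parseval[OF e(2)]) (auto simp: z_def)
    then have z0: "z = 0\<^sub>v n"
      by (intro real_scalar_prod_self_eq_0) (auto simp: z_def)
    have z_idx: "(\<Sum>j<k. x j * f j $ r) + x k * y $ r = 0" if "r < n" for r
      using z0 that by (auto simp: z_def lin_comb_def g_def vec_eq_iff)
    \<comment> \<open>Otherwise \<open>x\<close> would be a nontrivial relation among the
      \<open>f j\<close> alone. The relation can therefore be solved for \<open>y\<close>.\<close>
    have "x k \<noteq> 0"
    proof
      assume xk: "x k = 0"
      then have "lin_comb n {..<k} f x = 0\<^sub>v n"
        using z_idx by (auto simp: lin_comb_def)
      then show False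
        using indep[of x] x(1) xk by (auto simp: less_Suc_eq)
    qed
    have "y = lin_comb n {..<k} f (\<lambda>j. - x j / x k)"
    proof (rule eq_vecI)
      fix r assume "r < dim_vec (lin_comb n {..<k} f (\<lambda>j. - x j / x k))"
      then have r: "r < n"
        by (simp add: lin_comb_def)
      have "y $ r = - (\<Sum>j<k. x j * f j $ r) / x k"
        using z_idx[OF r] \<open>x k \<noteq> 0\<close> by (simp add: field_simps)
      also have "\<dots> = (\<Sum>j<k. - x j / x k * f j $ r)"
        by (simp add: sum_negf sum_divide_distrib)
      finally show "y $ r = lin_comb n {..<k} f (\<lambda>j. - x j / x k) $ r"
        using r by (simp add: lin_comb_def)
    qed (use y in \<open>simp add: lin_comb_def\<close>)
    then show ?thesis
      by blast
  qed
  moreover have "lin_comb n {..<k} f c \<bullet> e m = 0" if "m < n - k" for c m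
    using that fe ec by (simp add: lin_comb_scalar_prod)
  ultimately show thesis
    using that[OF e(2)] by blast
qed

section \<open>The maximum chordal distance\<close>

text \<open>\<open>V\<close> and \<open>W\<close> share the space of dimension \<open>n - d\<close>
  on which the first \<open>d\<close> coordinates vanish, and each adds one line, spanned by
  \<open>\<eta>\<close> and \<open>\<xi>\<close>. The first \<open>s - 1\<close> pairs of principal
  vectors use up the shared space; the last pair does at least as well as the unit vectors of the
  two lines, so its cosine is at least the modulus of their scalar product.\<close>

lemma max_chordal_dist_le:
  fixes \<eta> \<xi> :: "nat \<Rightarrow> real"
  assumes e: "orthonormal n n e" and d: "0 < d" "d \<le> n" and s: "s = Suc (n - d)"
    and \<eta>: "(\<Sum>m<d. (\<eta> m)\<^sup>2) = 1" and \<xi>: "(\<Sum>m<d. (\<xi> m)\<^sup>2) = 1"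
    and g: "\<bar>\<Sum>m<d. \<eta> m * \<xi> m\<bar> < 1"
    and V: "V = {y \<in> carrier_vec n. \<exists>a. \<forall>m<d. y \<bullet> e m = a * \<eta> m}"
    and W: "W = {y \<in> carrier_vec n. \<exists>a. \<forall>m<d. y \<bullet> e m = a * \<xi> m}"
  shows "max_chordal_dist s V W \<le> sqrt (1 - (\<Sum>m<d. \<eta> m * \<xi> m)\<^sup>2)"
proof -
  define g where "g = (\<Sum>m<d. \<eta> m * \<xi> m)"
  \<comment> \<open>Reversing \<open>\<xi>\<close> if necessary makes the scalar product of the two
    line vectors equal to \<open>\<bar>g\<bar>\<close>.\<close>
  define \<sigma> where "\<sigma> = (if 0 \<le> g then 1 else -1 :: real)"
  have \<sigma>: "\<sigma> * g = \<bar>g\<bar>" "\<sigma> * \<sigma> = 1"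
    by (auto simp: \<sigma>_def)
  have ec: "e m \<in> carrier_vec n" if "m < n" for m
    using e that by (auto simp: orthonormal_def)
  have ee: "e i \<bullet> e m = (if i = m then 1 else 0)" if "i < n" "m < n" for i m
    using e that by (auto simp: orthonormal_def)
  \<comment> \<open>Embeds coordinate vectors of length \<open>d\<close> into the orthogonal
    complement of the shared space.\<close>
  define L where "L = (\<lambda>\<zeta>. lin_comb n {..<d} e \<zeta>)"
  have Lc: "L \<zeta> \<in> carrier_vec n" for \<zeta>
    by (simp add: L_def)
  have Le: "L \<zeta> \<bullet> e m = (if m < d then \<zeta> m else 0)" if "m < n" for \<zeta> m
  proof -
    have "L \<zeta> \<bullet> e m = (\<Sum>j<d. \<zeta> j * (if j = m then 1 else 0))"
      unfolding L_def lin_comb_scalar_prod[OF ec[OF that]] using that d by (intro sum.cong) (auto simp: ee)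
    also have "\<dots> = (\<Sum>j<d. if j = m then \<zeta> j else 0)"
      by (intro sum.cong) auto
    finally show ?thesis
      by simp
  qed
  have head: "(\<Sum>m<n. (if m < d then F m else 0) * G m) = (\<Sum>m<d. F m * G m)" for F G :: "nat \<Rightarrow> real"
    using d by (intro sum.mono_neutral_cong_right) auto
  have Ly: "L \<zeta> \<bullet> y = (\<Sum>m<d. \<zeta> m * (y \<bullet> e m))" if "y \<in> carrier_vec n" for \<zeta> y
    using orthonormal_parseval[OF e Lc that] head by (simp add: Le)
  have LL: "L \<zeta> \<bullet> L \<theta> = (\<Sum>m<d. \<zeta> m * \<theta> m)" for \<zeta> \<theta>
    using d by (simp add: Ly[OF Lc] Le)
  have Vc: "V \<subseteq> carrier_vec n" and Wc: "W \<subseteq> carrier_vec n"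
    by (auto simp: V W)
  have LV: "L (\<lambda>m. t * \<eta> m) \<in> V" and LW: "L (\<lambda>m. t * \<xi> m) \<in> W" for t
    using Lc Le d by (auto simp: V W)
  have eV: "e (d + m) \<in> V" and eW: "e (d + m) \<in> W" if "m < n - d" for m
    using that d ec ee by (auto simp: V W intro!: exI[of _ 0])

  \<comment> \<open>\<open>SOME\<close> yields principal vectors only once their existence is known.\<close>
  define v\<^sub>0 where "v\<^sub>0 = (\<lambda>k. if k < n - d then e (d + k) else L \<eta>)"
  define w\<^sub>0 where "w\<^sub>0 = (\<lambda>k. if k < n - d then e (d + k) else L (\<lambda>m. \<sigma> * \<xi> m))"
  have ex: "principal_vectors s V W v\<^sub>0 w\<^sub>0"
    unfolding principal_vectors_def
  proof (intro allI impI conjI)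
    fix k assume "k < s"
    then consider (lt) "k < n - d" | (eq) "k = n - d"
      using s by linarith
    note k = this
    show "(v\<^sub>0 k, w\<^sub>0 k) \<in> principal_candidates V W v\<^sub>0 w\<^sub>0 k"
      using k
    proof cases
      case lt
      then show ?thesis
        using eV eW ee d by (auto simp: principal_candidates_def v\<^sub>0_def w\<^sub>0_def)
    next
      case eq
      have "L (\<lambda>m. \<sigma> * \<xi> m) \<bullet> L (\<lambda>m. \<sigma> * \<xi> m) = (\<Sum>m<d. (\<sigma> * \<sigma>) * (\<xi> m)\<^sup>2)"
        unfolding LL by (intro sum.cong) (auto simp: power2_eq_square)
      moreover have "L \<eta> \<bullet> L \<eta> = 1"
        using \<eta> by (simp add: LL power2_eq_square)
      moreover have "L \<eta> \<in> V"
        using LV[of 1] by simp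
      ultimately show ?thesis
        using eq LW[of \<sigma>] Le d \<sigma> \<xi>
        by (auto simp: principal_candidates_def v\<^sub>0_def w\<^sub>0_def)
    qed
    show "\<forall>(x, y)\<in>principal_candidates V W v\<^sub>0 w\<^sub>0 k. x \<bullet> y \<le> v\<^sub>0 k \<bullet> w\<^sub>0 k"
    proof safe
      fix x y assume xy: "(x, y) \<in> principal_candidates V W v\<^sub>0 w\<^sub>0 k"
      then have c: "x \<in> carrier_vec n" "y \<in> carrier_vec n" "x \<bullet> x = 1" "y \<bullet> y = 1"
        using Vc Wc by (auto simp: principal_candidates_def)
      show "x \<bullet> y \<le> v\<^sub>0 k \<bullet> w\<^sub>0 k"
        using k
      proof cases
        case lt
        then show ?thesis
          using unit_scalar_prod_le_1[OF c] ee[of "d + k" "d + k"] by (simp add: v\<^sub>0_def w\<^sub>0_def)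
      next
        case eq
        obtain a where a: "\<And>m. m < d \<Longrightarrow> x \<bullet> e m = a * \<eta> m"
          using xy by (auto simp: principal_candidates_def V)
        obtain b where b: "\<And>m. m < d \<Longrightarrow> y \<bullet> e m = b * \<xi> m"
          using xy by (auto simp: principal_candidates_def W)
        \<comment> \<open>Orthogonality to the earlier pairs removes the shared part, leaving
          multiples \<open>a\<close> and \<open>b\<close> of the unit line vectors; normalisation
          makes both of them 1 or -1.\<close>
        have "x \<bullet> e m = 0 \<and> y \<bullet> e m = 0" if "\<not> m < d" "m < n" for m
        proof -
          have "m - d < k"
            using that eq by simp
          then have "x \<bullet> v\<^sub>0 (m - d) = 0" "y \<bullet> w\<^sub>0 (m - d) = 0"
            using xy by (auto simp: principal_candidates_def)
          then show ?thesis
            using that by (auto simp: v\<^sub>0_def w\<^sub>0_def split: if_splits)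
        qed
        then have xe: "x \<bullet> e m = (if m < d then a * \<eta> m else 0)"
          and ye: "y \<bullet> e m = (if m < d then b * \<xi> m else 0)" if "m < n" for m
          using that a b by auto
        have "x \<bullet> x = (\<Sum>m<d. a * \<eta> m * (a * \<eta> m))" "y \<bullet> y = (\<Sum>m<d. b * \<xi> m * (b * \<xi> m))"
          "x \<bullet> y = (\<Sum>m<d. a * \<eta> m * (b * \<xi> m))"
          using orthonormal_parseval[OF e c(1) c(1)] orthonormal_parseval[OF e c(2) c(2)]
            orthonormal_parseval[OF e c(1) c(2)] d by (simp_all add: xe ye head)
        moreover have "(\<Sum>m<d. a * \<eta> m * (a * \<eta> m)) = a\<^sup>2 * (\<Sum>m<d. (\<eta> m)\<^sup>2)"
          "(\<Sum>m<d. b * \<xi> m * (b * \<xi> m)) = b\<^sup>2 * (\<Sum>m<d. (\<xi> m)\<^sup>2)"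
          "(\<Sum>m<d. a * \<eta> m * (b * \<xi> m)) = (a * b) * g"
          by (simp_all add: g_def sum_distrib_left power2_eq_square mult_ac)
        ultimately have "a\<^sup>2 = 1" "b\<^sup>2 = 1" "x \<bullet> y = a * b * g"
          using c \<eta> \<xi> by auto
        then have "x \<bullet> y \<le> \<bar>g\<bar>"
          by (auto simp: power2_eq_1_iff)
        also have "\<bar>g\<bar> = L \<eta> \<bullet> L (\<lambda>m. \<sigma> * \<xi> m)"
          unfolding LL \<sigma>(1)[symmetric] by (simp add: g_def sum_distrib_left mult_ac)
        finally show ?thesis
          using eq by (simp add: v\<^sub>0_def w\<^sub>0_def)
      qed
    qed
  qed

  define vw where "vw = (SOME (v, w). principal_vectors s V W v w)"
  define v where "v = fst vw"
  define w where "w = snd vw"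
  have "case vw of (v, w) \<Rightarrow> principal_vectors s V W v w"
    unfolding vw_def by (rule someI[where x = "(v\<^sub>0, w\<^sub>0)"]) (simp add: ex)
  then have pv: "principal_vectors s V W v w"
    by (simp add: v_def w_def case_prod_beta)
  have cand: "v k \<in> V" "w k \<in> W" "v k \<bullet> v k = 1" "w k \<bullet> w k = 1" if "k < s" for k
    using pv that by (auto simp: principal_vectors_def principal_candidates_def)
  have opt: "x \<bullet> y \<le> v k \<bullet> w k" if "k < s" "(x, y) \<in> principal_candidates V W v w k" for k x y
    using pv that by (fastforce simp: principal_vectors_def)
  \<comment> \<open>\<open>V \<inter> W\<close> is no larger than the shared space: coordinates
    proportional to both \<open>\<eta>\<close> and \<open>\<xi>\<close> satisfy
    \<open>a\<^sup>2 = a\<^sup>2 * \<bar>g\<bar>\<close>, and \<open>\<bar>g\<bar> < 1\<close>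
    forces \<open>a = 0\<close>.\<close>
  have VW: "y \<bullet> e m = 0" if y: "y \<in> V" "y \<in> W" and m: "m < d" for y m
  proof -
    obtain a where a: "\<And>m. m < d \<Longrightarrow> y \<bullet> e m = a * \<eta> m"
      using y by (auto simp: V)
    obtain b where b: "\<And>m. m < d \<Longrightarrow> y \<bullet> e m = b * \<xi> m"
      using y by (auto simp: W)
    have "a\<^sup>2 * (\<Sum>m<d. (\<eta> m)\<^sup>2) = (\<Sum>m<d. a * \<eta> m * (a * \<eta> m))"
      by (simp add: sum_distrib_left power2_eq_square mult_ac)
    also have "\<dots> = (\<Sum>m<d. a * \<eta> m * (b * \<xi> m))"
      using a b by (intro sum.cong) auto
    also have "\<dots> = a * b * g"
      by (simp add: g_def sum_distrib_left mult_ac)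
    finally have 1: "a\<^sup>2 = a * b * g"
      using \<eta> by simp
    have "b\<^sup>2 * (\<Sum>m<d. (\<xi> m)\<^sup>2) = (\<Sum>m<d. b * \<xi> m * (b * \<xi> m))"
      by (simp add: sum_distrib_left power2_eq_square mult_ac)
    also have "\<dots> = (\<Sum>m<d. a * \<eta> m * (b * \<xi> m))"
      using a b by (intro sum.cong) auto
    also have "\<dots> = a * b * g"
      by (simp add: g_def sum_distrib_left mult_ac)
    finally have "b\<^sup>2 = a\<^sup>2"
      using \<xi> 1 by simp
    then have "\<bar>b\<bar> = \<bar>a\<bar>"
      by (simp add: power2_eq_iff abs_eq_iff)
    then have "a\<^sup>2 = a\<^sup>2 * \<bar>g\<bar>"
      using arg_cong[OF 1, of abs] by (simp add: abs_mult power2_eq_square)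
    then have "a = 0"
      using g by (simp add: g_def)
    then show ?thesis
      using a m by simp
  qed
  \<comment> \<open>An arbitrary system of principal vectors first exhausts \<open>V \<inter> W\<close>, of dimension \<open>n - d\<close>.\<close>
  have agree: "v k = w k" if "k < n - d" for k
    using that
  proof (induction k rule: less_induct)
    case (less k)
    \<comment> \<open>As \<open>d + k < n\<close>, some unit vector \<open>u\<close> of the shared
      space is orthogonal to all earlier \<open>v j\<close>. The candidate \<open>(u, u)\<close>
      forces the optimal value 1, which only equal unit vectors attain.\<close>
    define h where "h = (\<lambda>j. if j < d then e j else v (j - d))"
    have "h j \<in> carrier_vec n" if "j < d + k" for j
      using that ec cand(1)[of "j - d"] Vc less.prems d s by (auto simp: h_def)
    moreover have "d + k < n"
      using less.prems by simp
    ultimately obtain u where u: "u \<in> carrier_vec n" "u \<bullet> u = 1" "\<And>j. j < d + k \<Longrightarrow> h j \<bullet> u = 0"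
      using exists_unit_orthogonal[of "d + k" n h] by metis
    have "u \<bullet> e m = 0" if "m < d" for m
      using u(3)[of m] that d real_scalar_prod_commute[OF u(1) ec[of m]] by (simp add: h_def)
    then have uVW: "u \<in> V" "u \<in> W"
      using u(1) by (auto simp: V W intro!: exI[of _ 0])
    have "u \<bullet> v j = 0" if "j < k" for j
    proof -
      have "v j \<in> carrier_vec n"
        using that less.prems cand(1)[of j] Vc s by auto
      then show ?thesis
        using u(3)[of "d + j"] that real_scalar_prod_commute[OF u(1)] by (simp add: h_def)
    qed
    moreover have "w j = v j" if "j < k" for j
      using that less by simp
    ultimately have "(u, u) \<in> principal_candidates V W v w k"
      using uVW u(2) by (simp add: principal_candidates_def)
    then have ge: "1 \<le> v k \<bullet> w k"
      using opt[of k u u] less.prems s u(2) by simp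
    have c: "v k \<in> carrier_vec n" "w k \<in> carrier_vec n" "v k \<bullet> v k = 1" "w k \<bullet> w k = 1"
      using cand[of k] less.prems s Vc Wc by auto
    show ?case
      using unit_scalar_prod_eq_1[OF c] unit_scalar_prod_le_1[OF c] ge by simp
  qed
  define t where "t = v (n - d) \<bullet> w (n - d)"
  have t1: "\<bar>t\<bar> \<le> 1"
    using unit_scalar_prod_le_1[of "v (n - d)" n "w (n - d)"] cand[of "n - d"] Vc Wc s by (auto simp: t_def)
  \<comment> \<open>The earlier \<open>v j\<close> equal \<open>w j\<close> and so lie in the shared
    space; hence the line vectors are still candidates at the last choice.\<close>
  have orth: "L \<zeta> \<bullet> v j = 0" if "j < n - d" for j \<zeta>
    using VW[of "v j"] cand[of j] agree[OF that] that s Vc by (subst Ly) auto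
  have "(L \<eta>, L (\<lambda>m. \<sigma> * \<xi> m)) \<in> principal_candidates V W v w (n - d)"
  proof -
    have "L (\<lambda>m. \<sigma> * \<xi> m) \<bullet> L (\<lambda>m. \<sigma> * \<xi> m) = (\<Sum>m<d. (\<sigma> * \<sigma>) * (\<xi> m)\<^sup>2)"
      unfolding LL by (intro sum.cong) (auto simp: power2_eq_square)
    moreover have "L \<eta> \<bullet> L \<eta> = 1"
      using \<eta> by (simp add: LL power2_eq_square)
    moreover have "L \<eta> \<in> V"
      using LV[of 1] by simp
    ultimately show ?thesis
      using LW[of \<sigma>] \<sigma> \<xi> orth agree by (auto simp: principal_candidates_def)
  qed
  then have "L \<eta> \<bullet> L (\<lambda>m. \<sigma> * \<xi> m) \<le> t"
    unfolding t_def by (intro opt) (auto simp: s)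
  also have "L \<eta> \<bullet> L (\<lambda>m. \<sigma> * \<xi> m) = \<bar>g\<bar>"
    unfolding LL \<sigma>(1)[symmetric] by (simp add: g_def sum_distrib_left mult_ac)
  finally have "\<bar>g\<bar>\<^sup>2 \<le> t\<^sup>2"
    by (intro power_mono) auto
  \<comment> \<open>The largest angle has number 1 but is chosen last, at position
    \<open>s - 1 = n - d\<close>.\<close>
  moreover have "principal_angle s V W 1 = arccos t"
    unfolding principal_angle_def vw_def[symmetric]
    by (simp add: case_prod_beta t_def v_def w_def s)
  then have "max_chordal_dist s V W = sqrt (1 - t\<^sup>2)"
    using t1 by (simp add: max_chordal_dist_def sin_arccos_abs)
  ultimately show ?thesis
    by (simp add: g_def)
qed

section \<open>Column spans and the spark\<close>

text \<open>\<open>submatrix\<close> addresses the selected columns by position through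
  \<open>pick\<close>; the bijection turns sums over positions into sums over
  \<open>J\<close>.\<close>

lemma bij_betw_pick:
  assumes "finite J"
  shows "bij_betw (pick J) {..<card J} J"
proof -
  have "pick J ` {..<card J} = J"
  proof safe
    fix j assume "j < card J"
    then show "pick J j \<in> J"
      by (rule pick_in_set_le)
  next
    fix i assume i: "i \<in> J"
    then have "card {a \<in> J. a < i} < card J"
      using assms by (intro psubset_card_mono) auto
    then show "i \<in> pick J ` {..<card J}"
      using pick_card_in_set[OF i] by (intro image_eqI[of _ _ "card {a \<in> J. a < i}"]) auto
  qed
  moreover from this have "inj_on (pick J) {..<card J}"
    by (intro eq_card_imp_inj_on) auto
  ultimately show ?thesis
    by (simp add: bij_betw_def)
qed

lemma submatrix_cols_carrier:
  assumes "A \<in> carrier_mat n p" "J \<subseteq> {..<p}"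
  shows "submatrix A UNIV J \<in> carrier_mat n (card J)"
proof -
  have "{j. j < p \<and> j \<in> J} = J"
    using assms(2) by auto
  then show ?thesis
    using assms(1) by (intro carrier_matI) (simp_all add: dim_submatrix)
qed

lemma submatrix_cols_mult_vec:
  assumes A: "A \<in> carrier_mat n p" and J: "J \<subseteq> {..<p}"
  shows "submatrix A UNIV J *\<^sub>v vec (card J) (\<lambda>i. c (pick J i)) = lin_comb n J (col A) c"
proof (rule eq_vecI)
  fix r assume "r < dim_vec (lin_comb n J (col A) c)"
  then have r: "r < n"
    by (simp add: lin_comb_def)
  have fin: "finite J"
    using J finite_subset by blast
  have B: "submatrix A UNIV J \<in> carrier_mat n (card J)"
    by (rule submatrix_cols_carrier[OF assms])
  have JJ: "{j. j < dim_col A \<and> j \<in> J} = J"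
    using A J by auto
  have idx: "submatrix A UNIV J $$ (r, i) = A $$ (r, pick J i)" if "i < card J" for i
    using submatrix_index[of r A UNIV i J] that r A JJ by (simp add: pick_UNIV)
  have pick: "pick J i < p" if "i < card J" for i
    using pick_in_set_le[OF that] J by auto
  have "(submatrix A UNIV J *\<^sub>v vec (card J) (\<lambda>i. c (pick J i))) $ r
      = (\<Sum>i<card J. A $$ (r, pick J i) * c (pick J i))"
    using B r by (auto simp: scalar_prod_eq_sum[of _ "card J"] idx intro!: sum.cong)
  also have "\<dots> = (\<Sum>j\<in>J. A $$ (r, j) * c j)"
    by (rule sum.reindex_bij_betw[OF bij_betw_pick[OF fin]])
  also have "\<dots> = (\<Sum>j\<in>J. c j * col A j $ r)"
    using A J r by (intro sum.cong) auto
  finally show "(submatrix A UNIV J *\<^sub>v vec (card J) (\<lambda>i. c (pick J i))) $ r = lin_comb n J (col A) c $ r"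
    using r by (simp add: lin_comb_def)
qed (use submatrix_cols_carrier[OF assms] in \<open>simp add: lin_comb_def\<close>)

lemma col_span_eq_lin_comb:
  assumes A: "A \<in> carrier_mat n p" and J: "J \<subseteq> {..<p}"
  shows "col_span A J = range (lin_comb n J (col A))"
proof -
  have fin: "finite J"
    using J finite_subset by blast
  have B: "submatrix A UNIV J \<in> carrier_mat n (card J)"
    by (rule submatrix_cols_carrier[OF assms])
  have "col_span A J = {y \<in> carrier_vec n. \<exists>x \<in> carrier_vec (card J). submatrix A UNIV J *\<^sub>v x = y}"
    unfolding col_span_def using A B vec_space.col_space_eq[of "submatrix A UNIV J" n "card J"] by simp
  also have "\<dots> = range (lin_comb n J (col A))"
  proof safe
    fix x :: "real vec" assume x: "x \<in> carrier_vec (card J)"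
    define c where "c = (\<lambda>j. x $ the_inv_into {..<card J} (pick J) j)"
    have "c (pick J i) = x $ i" if "i < card J" for i
      using bij_betw_pick[OF fin] that by (simp add: c_def bij_betw_def the_inv_into_f_f)
    then have "x = vec (card J) (\<lambda>i. c (pick J i))"
      using x by (intro eq_vecI) auto
    then have "submatrix A UNIV J *\<^sub>v x = lin_comb n J (col A) c"
      using submatrix_cols_mult_vec[OF assms, of c] by simp
    then show "submatrix A UNIV J *\<^sub>v x \<in> range (lin_comb n J (col A))"
      by simp
  next
    fix c
    show "\<exists>x\<in>carrier_vec (card J). submatrix A UNIV J *\<^sub>v x = lin_comb n J (col A) c"
      using submatrix_cols_mult_vec[OF assms, of c] by (intro bexI[of _ "vec (card J) (\<lambda>i. c (pick J i))"]) auto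
  qed simp
  finally show ?thesis .
qed

text \<open>Full column rank makes the columns independent as a set; distinctness is added so that a
  kernel vector really yields a dependency.\<close>

lemma full_rank_mult_vec_eq_0:
  fixes B :: "real mat"
  assumes B: "B \<in> carrier_mat n k" and rank: "\<not> vec_space.rank n B < k"
    and x: "x \<in> carrier_vec k" "B *\<^sub>v x = 0\<^sub>v n"
  shows "x = 0\<^sub>v k"
proof (rule ccontr)
  interpret vec_space "TYPE(real)" n .
  assume x0: "x \<noteq> 0\<^sub>v k"
  have rk: "rank B = k"
    using rank rank_le_nc[OF B] by simp
  \<comment> \<open>With a repeated column, a maximal independent set of columns, whose size is the
    rank, would have fewer than \<open>k\<close> elements.\<close>
  have "distinct (cols B)"
  proof (rule ccontr)
    assume "\<not> distinct (cols B)"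
    then have lt: "card (set (cols B)) < k"
      using B card_length[of "cols B"] card_distinct[of "cols B"] by (auto simp: order_less_le)
    obtain S where S: "maximal S (\<lambda>T. T \<subseteq> set (cols B) \<and> lin_indpt T)"
      using maximal_exists[of "(\<lambda>T. T \<subseteq> set (cols B) \<and> lin_indpt T)" "card (set (cols B))" "{}"]
      by (meson List.finite_set card_mono empty_iff empty_subsetI finite_lin_indpt2 rev_finite_subset)
    then have "card S \<le> card (set (cols B))"
      by (simp add: card_mono maximal_def)
    then show False
      using rank_card_indpt[OF B S] lt rk by simp
  qed
  then show False
    using full_rank_lin_indpt[OF B rk] lin_depI[OF B x(1) x0 x(2)] by blast
qed

text \<open>A rank deficient submatrix on \<open>J\<close> would put \<open>card J\<close> into the
  set whose infimum is the spark.\<close>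

lemma cols_independent_below_spark:
  assumes A: "A \<in> carrier_mat n p" and J: "J \<subseteq> {..<p}"
    and spark: "enat (card J) < spark A"
    and eq: "lin_comb n J (col A) c = 0\<^sub>v n" and j: "j \<in> J"
  shows "c j = 0"
proof -
  have fin: "finite J"
    using J finite_subset by blast
  have "0 < card J"
    using j fin by (auto simp: card_gt_0_iff)
  then have "\<not> vec_space.rank n (submatrix A UNIV J) < card J"
  proof -
    have "spark A \<le> enat (card J)" if "vec_space.rank n (submatrix A UNIV J) < card J"
      unfolding spark_def using that \<open>0 < card J\<close> A J by (intro Inf_lower) auto
    then show ?thesis
      using spark by auto
  qed
  moreover have "submatrix A UNIV J *\<^sub>v vec (card J) (\<lambda>i. c (pick J i)) = 0\<^sub>v n"
    using submatrix_cols_mult_vec[OF A J] eq by (rule trans)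
  ultimately have zero: "vec (card J) (\<lambda>i. c (pick J i)) = 0\<^sub>v (card J)"
    by (rule full_rank_mult_vec_eq_0[OF submatrix_cols_carrier[OF A J] _ vec_carrier])
  have "c (pick J i) = 0" if "i < card J" for i
    using arg_cong[OF zero, of "\<lambda>v. v $ i"] that by simp
  moreover obtain i where "i < card J" "j = pick J i"
    using bij_betw_imp_surj_on[OF bij_betw_pick[OF fin]] j by blast
  ultimately show ?thesis
    by simp
qed

section \<open>From the chordal distance condition to a packing of lines\<close>

text \<open>The first \<open>s - 1\<close> columns are kept fixed and each of the remaining
  \<open>p - s + 1\<close> is added in turn. Projecting the added columns to the orthogonal
  complement and normalising gives the unit vectors for \<open>spherical_packing_bound\<close> with
  \<open>r = \<delta>\<close>.\<close>

lemma packing_of_column_lines: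
  assumes A: "A \<in> carrier_mat n p" and s: "0 < s" "s \<le> n" "s < p"
    and spark: "enat (2 * s) < spark A"
    and \<delta>: "0 < \<delta>" "2 * \<delta> < 1" and \<epsilon>: "0 < \<epsilon>" "\<epsilon> < \<delta>"
    and chordal: "\<And>V W. V \<in> col_subspaces A s \<Longrightarrow> W \<in> col_subspaces A s \<Longrightarrow> V \<noteq> W \<Longrightarrow>
      2 * \<delta> \<le> max_chordal_dist s V W"
  shows "(real p - real s + 1) * (\<delta> ^ Suc (n - s) - 2 * sqrt (\<delta>\<^sup>2 - \<epsilon>\<^sup>2) ^ Suc (n - s))
      \<le> 2 * sqrt (1 + 2 * \<epsilon>) ^ Suc (n - s)"
proof -
  define k where "k = s - 1"
  define f where "f = col A"
  define F where "F = {k..<p}"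
  define d where "d = n - k"
  have k: "s = Suc k" "k \<le> n" "s = Suc (n - d)" "0 < d" "d \<le> n" "Suc (n - s) = d"
    using s by (auto simp: k_def d_def)
  have fc: "f j \<in> carrier_vec n" for j
    using A by (intro carrier_vecI) (simp add: f_def)
  have indep: "c j = 0" if "lin_comb n J f c = 0\<^sub>v n" "j \<in> J" "J \<subseteq> {..<p}" "card J \<le> 2 * s" for c j J
  proof -
    have "enat (card J) < spark A"
      using that(4) spark by (meson enat_ord_simps(1) order_le_less_trans)
    then show ?thesis
      using cols_independent_below_spark[OF A that(3)] that(1,2) by (simp add: f_def)
  qed
  obtain e where e: "orthonormal n n e"
    and frame: "\<And>y. y \<in> carrier_vec n \<Longrightarrow> (\<forall>m<d. y \<bullet> e m = 0) \<longleftrightarrow> (\<exists>c. y = lin_comb n {..<k} f c)"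
  proof (rule exists_frame_adapted_to_span[of k f n])
    fix c j assume "lin_comb n {..<k} f c = 0\<^sub>v n" "j < k"
    then show "c j = 0"
      using indep[of "{..<k}" c j] s k by auto
  qed (use fc k d_def in auto)
  have ec: "e m \<in> carrier_vec n" if "m < d" for m
    using e that k by (auto simp: orthonormal_def)
  have fe: "f j \<bullet> e m = 0" if "j < k" "m < d" for j m
  proof -
    have "f j = lin_comb n {..<k} f (\<lambda>i. if i = j then 1 else 0)"
      using fc[of j] that(1)
      by (intro eq_vecI) (simp_all add: lin_comb_def if_distrib[of "\<lambda>x. x * _"] cong: if_cong)
    then show ?thesis
      using frame[OF fc] that(2) by blast
  qed
  \<comment> \<open>A relation between two projected columns lifts to one among
    \<open>k + 2 = s + 1\<close> columns, at most \<open>2 * s\<close> and hence below the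
    spark.\<close>
  have tails_independent: "a = 0 \<and> b = 0"
    if ij: "i \<in> F" "j \<in> F" "i \<noteq> j" and ab: "\<And>m. m < d \<Longrightarrow> a * (f i \<bullet> e m) + b * (f j \<bullet> e m) = 0"
    for i j a b
  proof -
    define y where "y = lin_comb n {i, j} f (\<lambda>x. if x = i then a else b)"
    have "y \<bullet> e m = 0" if "m < d" for m
      using ij ab[OF that] by (simp add: y_def lin_comb_scalar_prod[OF ec[OF that]])
    then obtain c where c: "y = lin_comb n {..<k} f c"
      using frame[of y] by (auto simp: y_def)
    define c' where "c' = (\<lambda>x. if x < k then - c x else if x = i then a else b)"
    have "lin_comb n ({..<k} \<union> {i, j}) f c' = 0\<^sub>v n"
    proof (rule eq_vecI)
      fix r assume "r < dim_vec (0\<^sub>v n :: real vec)"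
      then have r: "r < n"
        by simp
      have "(\<Sum>x\<in>{..<k} \<union> {i, j}. c' x * f x $ r) = (\<Sum>x<k. c' x * f x $ r) + (\<Sum>x\<in>{i, j}. c' x * f x $ r)"
        using ij by (intro sum.union_disjoint) (auto simp: F_def)
      also have "(\<Sum>x<k. c' x * f x $ r) = - (lin_comb n {..<k} f c $ r)"
        using r by (simp add: lin_comb_def c'_def sum_negf)
      also have "(\<Sum>x\<in>{i, j}. c' x * f x $ r) = y $ r"
        using r ij by (simp add: y_def lin_comb_def c'_def F_def)
      finally show "lin_comb n ({..<k} \<union> {i, j}) f c' $ r = 0\<^sub>v n $ r"
        using r c by (simp add: lin_comb_def)
    qed (simp add: lin_comb_def)
    moreover have "card ({..<k} \<union> {i, j}) \<le> 2 * s"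
    proof -
      have "card ({..<k} \<union> {i, j}) \<le> k + card {i, j}"
        using card_Un_le[of "{..<k}" "{i, j}"] by simp
      then show ?thesis
        using ij k by simp
    qed
    moreover have "{..<k} \<union> {i, j} \<subseteq> {..<p}"
      using ij s k by (auto simp: F_def)
    ultimately have "c' i = 0" "c' j = 0"
      using indep[of "{..<k} \<union> {i, j}" c'] by auto
    then show ?thesis
      using ij by (auto simp: c'_def F_def)
  qed
  define N where "N = (\<lambda>i. \<Sum>m<d. (f i \<bullet> e m)\<^sup>2)"
  have N: "0 < N i" if i: "i \<in> F" for i
  proof (rule ccontr)
    assume "\<not> 0 < N i"
    moreover have "0 \<le> N i"
      by (simp add: N_def sum_nonneg)
    ultimately have "N i = 0"
      by simp
    then have z: "f i \<bullet> e m = 0" if "m < d" for m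
      using that by (auto simp: N_def sum_nonneg_eq_0_iff)
    \<comment> \<open>A second index, available because \<open>s < p\<close>, lets
      \<open>tails_independent\<close> be applied with coefficients 1 and 0.\<close>
    define j where "j = (if i = k then s else k)"
    have "j \<in> F" "i \<noteq> j"
      using s k by (auto simp: j_def F_def)
    then show False
      using tails_independent[OF i \<open>j \<in> F\<close> \<open>i \<noteq> j\<close>, of 1 0] z by simp
  qed
  define \<eta> where "\<eta> = (\<lambda>i m. (f i \<bullet> e m) / sqrt (N i))"
  have unit: "(\<Sum>m<d. (\<eta> i m)\<^sup>2) = 1" if "i \<in> F" for i
  proof -
    have "(\<Sum>m<d. (\<eta> i m)\<^sup>2) = N i / N i"
      using N[OF that] by (simp add: \<eta>_def power_divide less_imp_le flip: sum_divide_distrib) (simp add: N_def)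
    then show ?thesis
      using N[OF that] by simp
  qed
  define V where "V = (\<lambda>i. col_span A (insert i {..<k}))"
  have V: "V i = {y \<in> carrier_vec n. \<exists>a. \<forall>m<d. y \<bullet> e m = a * \<eta> i m}" if i: "i \<in> F" for i
  proof -
    have "V i = range (lin_comb n (insert i {..<k}) f)"
      unfolding V_def f_def using i k s by (intro col_span_eq_lin_comb[OF A]) (auto simp: F_def)
    also have "\<dots> = {y \<in> carrier_vec n. \<exists>a. \<forall>m<d. y \<bullet> e m = a * \<eta> i m}"
    proof (intro equalityI subsetI)
      fix y assume "y \<in> range (lin_comb n (insert i {..<k}) f)"
      then obtain c where y: "y = lin_comb n (insert i {..<k}) f c"
        by auto
      have "y \<bullet> e m = c i * sqrt (N i) * \<eta> i m" if m: "m < d" for m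
        using i N[OF i] fe[OF _ m] by (simp add: y lin_comb_scalar_prod[OF ec[OF m]] F_def \<eta>_def)
      then show "y \<in> {y \<in> carrier_vec n. \<exists>a. \<forall>m<d. y \<bullet> e m = a * \<eta> i m}"
        by (auto simp: y)
    next
      fix y assume "y \<in> {y \<in> carrier_vec n. \<exists>a. \<forall>m<d. y \<bullet> e m = a * \<eta> i m}"
      then obtain a where y: "y \<in> carrier_vec n" and a: "\<And>m. m < d \<Longrightarrow> y \<bullet> e m = a * \<eta> i m"
        by auto
      \<comment> \<open>Subtracting \<open>b\<close> times \<open>f i\<close> kills the first
        \<open>d\<close> coordinates, so by \<open>frame\<close> the remainder lies in the span of
        the fixed columns.\<close>
      define b where "b = a / sqrt (N i)"
      have "(y - b \<cdot>\<^sub>v f i) \<bullet> e m = 0" if m: "m < d" for m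
        using y fc ec[OF m] a[OF m]
        by (simp add: minus_scalar_prod_distrib[of _ n] b_def \<eta>_def)
      then obtain c where c: "y - b \<cdot>\<^sub>v f i = lin_comb n {..<k} f c"
        using frame[of "y - b \<cdot>\<^sub>v f i"] y fc by auto
      have "y = lin_comb n (insert i {..<k}) f (c(i := b))"
      proof (rule eq_vecI)
        fix r assume "r < dim_vec (lin_comb n (insert i {..<k}) f (c(i := b)))"
        then have r: "r < n"
          by (simp add: lin_comb_def)
        have "(y - b \<cdot>\<^sub>v f i) $ r = (\<Sum>j<k. c j * f j $ r)"
          using c r by (simp add: lin_comb_def)
        moreover have "(y - b \<cdot>\<^sub>v f i) $ r = y $ r - b * f i $ r"
          using y fc[of i] r by simp
        moreover have "(\<Sum>j<k. (c(i := b)) j * f j $ r) = (\<Sum>j<k. c j * f j $ r)"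
          using i by (intro sum.cong) (auto simp: F_def)
        ultimately show "y $ r = lin_comb n (insert i {..<k}) f (c(i := b)) $ r"
          using r i by (simp add: lin_comb_def F_def)
      qed (use y in \<open>simp add: lin_comb_def\<close>)
      then show "y \<in> range (lin_comb n (insert i {..<k}) f)"
        by blast
    qed
    finally show ?thesis .
  qed
  have sep: "(\<Sum>m<d. \<eta> i m * \<eta> j m) < 1 - 2 * \<delta>\<^sup>2" if ij: "i \<in> F" "j \<in> F" "i \<noteq> j" for i j
  proof -
    define g where "g = (\<Sum>m<d. \<eta> i m * \<eta> j m)"
    \<comment> \<open>Equality in Cauchy-Schwarz would make the two unit vectors equal up to sign,
      against \<open>tails_independent\<close>.\<close>
    have g: "\<bar>g\<bar> < 1"
    proof (rule ccontr)
      assume neg: "\<not> \<bar>g\<bar> < 1"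
      define \<tau> where "\<tau> = (if 0 \<le> g then 1 else -1 :: real)"
      have \<tau>: "\<tau> * g = \<bar>g\<bar>" "\<tau>\<^sup>2 = 1"
        by (auto simp: \<tau>_def)
      have "(\<Sum>m<d. (\<eta> i m - \<tau> * \<eta> j m)\<^sup>2)
          = (\<Sum>m<d. (\<eta> i m)\<^sup>2) - 2 * (\<tau> * g) + \<tau>\<^sup>2 * (\<Sum>m<d. (\<eta> j m)\<^sup>2)"
        by (simp add: g_def power2_diff sum.distrib sum_subtractf sum_distrib_left power_mult_distrib mult_ac)
      then have "(\<Sum>m<d. (\<eta> i m - \<tau> * \<eta> j m)\<^sup>2) \<le> 0"
        using neg unit ij \<tau> by simp
      then have "(\<Sum>m<d. (\<eta> i m - \<tau> * \<eta> j m)\<^sup>2) = 0"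
        by (intro antisym sum_nonneg) auto
      then have "\<eta> i m = \<tau> * \<eta> j m" if "m < d" for m
        using that by (auto simp: sum_nonneg_eq_0_iff)
      then show False
        using tails_independent[OF ij, of "1 / sqrt (N i)" "- \<tau> / sqrt (N j)"] N[OF ij(1)]
        by (simp add: \<eta>_def)
    qed
    have "V i \<noteq> V j"
    proof
      assume eq: "V i = V j"
      have "f i \<bullet> e m = sqrt (N i) * \<eta> i m" for m
        using N[OF ij(1)] by (simp add: \<eta>_def)
      then have "f i \<in> V j"
        using fc V[OF ij(1)] eq by auto
      then obtain a where "\<And>m. m < d \<Longrightarrow> f i \<bullet> e m = a * \<eta> j m"
        using V[OF ij(2)] by auto
      then show False
        using tails_independent[OF ij, of 1 "- a / sqrt (N j)"] by (simp add: \<eta>_def)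
    qed
    moreover have "V l \<in> col_subspaces A s" if "l \<in> F" for l
      unfolding col_subspaces_def V_def using that k s A
      by (intro CollectI exI[of _ "insert l {..<k}"]) (auto simp: F_def)
    ultimately have "2 * \<delta> \<le> max_chordal_dist s (V i) (V j)"
      using chordal ij by blast
    also have "\<dots> \<le> sqrt (1 - g\<^sup>2)"
      unfolding g_def using g
      by (intro max_chordal_dist_le[OF e k(4,5,3) unit[OF ij(1)] unit[OF ij(2)] _ V[OF ij(1)] V[OF ij(2)]])
        (simp add: g_def)
    finally have "(2 * \<delta>)\<^sup>2 \<le> (sqrt (1 - g\<^sup>2))\<^sup>2"
      using \<delta> by (intro power_mono) auto
    also have "\<dots> = 1 - g\<^sup>2"
      using g by (simp add: abs_square_le_1)
    finally have "g\<^sup>2 \<le> 1 - 4 * \<delta>\<^sup>2"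
      by (simp add: power_mult_distrib)
    \<comment> \<open>The two sides differ by four times the fourth power of
      \<open>\<delta>\<close>. In terms of angles, a sine of at least \<open>2 * \<delta>\<close>
      forces the sine of half the angle above \<open>\<delta>\<close>.\<close>
    also have "\<dots> < (1 - 2 * \<delta>\<^sup>2)\<^sup>2"
      using \<delta> by (simp add: power2_diff power_mult_distrib)
    finally have "g\<^sup>2 < (1 - 2 * \<delta>\<^sup>2)\<^sup>2" .
    moreover have "\<delta>\<^sup>2 \<le> (1/2)\<^sup>2"
      using \<delta> by (intro power_mono) auto
    ultimately show ?thesis
      unfolding g_def[symmetric] by (intro power2_less_imp_less[of g]) (auto simp: power2_eq_square)
  qed
  have "real (card F) * (\<delta> ^ d - 2 * sqrt (\<delta>\<^sup>2 - \<epsilon>\<^sup>2) ^ d) \<le> 2 * sqrt (1 + 2 * \<epsilon>) ^ d"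
    using \<delta> \<epsilon> unit sep by (intro spherical_packing_bound[where y = \<eta>]) (auto simp: F_def)
  moreover have "real (card F) = real p - real s + 1"
    using s k by (simp add: F_def of_nat_diff)
  ultimately show ?thesis
    using k(6) by simp
qed

section \<open>Asymptotics\<close>

text \<open>Bounding \<open>ln q\<close> by its tangent at \<open>u\<close> makes the terms in \<open>q\<close> cancel.\<close>
lemma c_const_slack:
  assumes "0 < \<gamma>" "\<gamma> < 1 / 2" "0 < \<delta>\<^sub>1" "\<delta>\<^sub>1 < 1"
  shows "c_const \<gamma> \<delta>\<^sub>1 + \<gamma> + 1 / 2 * ln (1 - 2 * \<gamma>) < 0"
proof -
  define q where "q = 1 / (1 - \<delta>\<^sub>1\<^sup>2)"
  have "\<delta>\<^sub>1\<^sup>2 < 1"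
    using assms by (simp add: power_less_one_iff abs_square_less_1)
  then have q: "0 < q" and q': "q * \<delta>\<^sub>1\<^sup>2 = q - 1"
    by (auto simp: q_def field_simps)
  \<comment> \<open>The point at which \<open>(1 - \<gamma>) * ln q - q * (1 - 2 * \<gamma>)\<close>
    is maximal as a function of \<open>q\<close>.\<close>
  define u where "u = (1 - \<gamma>) / (1 - 2 * \<gamma>)"
  have u: "0 < u"
    using assms by (simp add: u_def)
  have "ln q = ln u + ln (q / u)"
    using q u by (simp add: ln_div)
  also have "ln (q / u) \<le> q / u - 1"
    using q u by (intro ln_le_minus_one) auto
  finally have "(1 - \<gamma>) * ln q \<le> (1 - \<gamma>) * (ln u + (q / u - 1))"
    using assms by (intro mult_left_mono) auto
  also have "\<dots> = (1 - \<gamma>) * (ln (1 - \<gamma>) - ln (1 - 2 * \<gamma>)) + q * (1 - 2 * \<gamma>) - (1 - \<gamma>)"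
  proof -
    have "ln u = ln (1 - \<gamma>) - ln (1 - 2 * \<gamma>)"
      using assms by (simp add: u_def ln_div)
    moreover have "(1 - \<gamma>) * (q / u) = q * (1 - 2 * \<gamma>)"
      using assms by (simp add: u_def)
    moreover have "(1 - \<gamma>) * (ln u + (q / u - 1)) = (1 - \<gamma>) * ln u + (1 - \<gamma>) * (q / u) - (1 - \<gamma>)"
      by (simp add: distrib_left right_diff_distrib)
    ultimately show ?thesis
      by simp
  qed
  finally have 1: "(1 - \<gamma>) * ln q \<le>
      (1 - \<gamma>) * ln (1 - \<gamma>) - (1 - \<gamma>) * ln (1 - 2 * \<gamma>) + q * (1 - 2 * \<gamma>) - (1 - \<gamma>)"
    by (simp add: algebra_simps)
  \<comment> \<open>What remains is \<open>(1 - \<gamma>) * ln (1 - \<gamma>) + \<gamma> * ln (1 - 2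
    * \<gamma>) + \<gamma>\<close>, and these estimates bound it by
    \<open>- (\<gamma> * \<gamma>)\<close>.\<close>
  have "(1 - \<gamma>) * ln (1 - \<gamma>) \<le> (1 - \<gamma>) * (- \<gamma>)"
    using assms ln_le_minus_one[of "1 - \<gamma>"] by (intro mult_left_mono) auto
  moreover have "\<gamma> * ln (1 - 2 * \<gamma>) \<le> \<gamma> * (- 2 * \<gamma>)"
    using assms ln_le_minus_one[of "1 - 2 * \<gamma>"] by (intro mult_left_mono) auto
  moreover have "0 < \<gamma> * \<gamma>"
    using assms by simp
  ultimately have 2: "(1 - \<gamma>) * ln q - (q - 1) * (1 - 2 * \<gamma>) + 2 * \<gamma> + ln (1 - 2 * \<gamma>) < 0"
    using 1 by (simp add: algebra_simps)
  have "c_const \<gamma> \<delta>\<^sub>1 = ln q / 2 * (1 - \<gamma>) - 1 / 2 * (q * \<delta>\<^sub>1\<^sup>2) * (1 - 2 * \<gamma>)"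
    by (simp add: c_const_def q_def)
  also have "\<dots> = ((1 - \<gamma>) * ln q - (q - 1) * (1 - 2 * \<gamma>)) / 2"
    unfolding q' by (simp add: field_simps)
  finally show ?thesis
    using 2 by simp
qed

text \<open>With \<open>d = n - s n + 1\<close>, asymptotically \<open>(1 - \<gamma>) * n\<close>,
  the packing bound gives at most 4 times the \<open>d\<close>-th power of
  \<open>sqrt (1 + 2 * \<epsilon>) / \<delta>\<close>. The strict inequality for \<open>C\<close>
  absorbs constants and the error in \<open>s n / n\<close>.\<close>

lemma eventually_ln_packing_bound:
  fixes p s :: "nat \<Rightarrow> nat"
  assumes \<epsilon>: "0 < \<epsilon>" "\<epsilon> < \<delta>" and \<delta>: "\<delta> < 1"
    and \<gamma>: "0 < \<gamma>" "\<gamma> < 1" and s_lim: "(\<lambda>n. real (s n) / real n) \<longlonglongrightarrow> \<gamma>"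
    and C: "(1 - \<gamma>) * (ln (1 / \<delta>) + \<epsilon>) < C" "0 < C"
    and pack: "\<forall>\<^sub>F n in sequentially. s n < p n \<longrightarrow> (real (p n) - real (s n) + 1) *
      (\<delta> ^ Suc (n - s n) - 2 * sqrt (\<delta>\<^sup>2 - \<epsilon>\<^sup>2) ^ Suc (n - s n)) \<le> 2 * sqrt (1 + 2 * \<epsilon>) ^ Suc (n - s n)"
  shows "\<forall>\<^sub>F n in sequentially. ln (real (p n) - real (s n)) \<le> C * real n"
proof -
  define \<rho> where "\<rho> = sqrt (\<delta>\<^sup>2 - \<epsilon>\<^sup>2)"
  \<comment> \<open>The summand \<open>\<epsilon>\<close> bounds the logarithm of
    \<open>sqrt (1 + 2 * \<epsilon>)\<close>.\<close>
  define K where "K = ln (1 / \<delta>) + \<epsilon>"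
  have \<delta>0: "0 < \<delta>"
    using \<epsilon> by simp
  have "\<rho> < sqrt (\<delta>\<^sup>2)"
    unfolding \<rho>_def using \<epsilon> by (intro real_sqrt_less_mono) auto
  then have \<rho>: "0 \<le> \<rho>" "\<rho> / \<delta> < 1"
    using \<delta>0 \<epsilon> by (auto simp: \<rho>_def power_mono)
  then have "(\<lambda>d. (\<rho> / \<delta>) ^ d) \<longlonglongrightarrow> 0"
    using \<delta>0 by (intro LIMSEQ_realpow_zero) auto
  \<comment> \<open>The threshold 1/4 makes the subtracted \<open>2 * \<rho> ^ d\<close> less than
    half of \<open>\<delta> ^ d\<close>.\<close>
  then have "\<forall>\<^sub>F d in sequentially. (\<rho> / \<delta>) ^ d < 1 / 4"
    by (rule order_tendstoD) simp
  then obtain D where D: "\<And>d. D \<le> d \<Longrightarrow> (\<rho> / \<delta>) ^ d < 1 / 4"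
    by (auto simp: eventually_sequentially)
  \<comment> \<open>Room above \<open>\<gamma>\<close> makes \<open>n - s n\<close> grow at least
    linearly, so that \<open>d\<close> eventually passes \<open>D\<close>.\<close>
  obtain \<gamma>' where \<gamma>': "\<gamma> < \<gamma>'" "\<gamma>' < 1"
    using dense \<gamma>(2) by blast
  have s_lt: "\<forall>\<^sub>F n in sequentially. real (s n) / real n < \<gamma>'"
    using s_lim \<gamma>'(1) by (rule order_tendstoD)
  have "(\<lambda>n. (ln 4 + K) / real n + K * (1 - real (s n) / real n)) \<longlonglongrightarrow> 0 + K * (1 - \<gamma>)"
    by (intro tendsto_intros s_lim lim_const_over_n)
  then have lin: "\<forall>\<^sub>F n in sequentially. (ln 4 + K) / real n + K * (1 - real (s n) / real n) < C"
    using C(1) by (intro order_tendstoD(2)) (auto simp: K_def mult.commute)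
  \<comment> \<open>Serves the degenerate case \<open>p n < s n\<close>.\<close>
  have "(\<lambda>n. ln (real n) / real n) \<longlonglongrightarrow> 0"
    using lim_ln_over_n by simp
  then have lnn: "\<forall>\<^sub>F n in sequentially. ln (real n) / real n < C"
    using C(2) by (rule order_tendstoD)
  have large: "\<forall>\<^sub>F n in sequentially. real D / (1 - \<gamma>') \<le> real n"
    using filterlim_real_sequentially by (auto simp: filterlim_at_top)
  show ?thesis
    using pack s_lt lin lnn large eventually_gt_at_top[of 0]
  proof eventually_elim
    case (elim n)
    have n: "0 < real n"
      using elim by simp
    have s\<gamma>': "real (s n) < \<gamma>' * real n"
      using elim n by (simp add: field_simps)
    also have "\<dots> \<le> 1 * real n"
      using \<gamma>' by (intro mult_right_mono) auto
    finally have sn: "s n < n"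
      by simp
    show ?case
    proof (cases "s n < p n")
      case False
      show ?thesis
      proof (cases "p n = s n")
        case True
        \<comment> \<open>By convention \<open>ln 0 = 0\<close>.\<close>
        then show ?thesis
          using C by simp
      next
        case neq: False
        \<comment> \<open>In HOL the logarithm is extended to negative numbers by \<open>ln (- x) = ln x\<close>.\<close>
        have "ln (real (p n) - real (s n)) = ln (real (s n) - real (p n))"
          using ln_minus[of "real (s n) - real (p n)"] by simp
        also have "\<dots> \<le> ln (real n)"
          using neq False sn by (subst ln_le_cancel_iff) auto
        also have "\<dots> \<le> C * real n"
          using elim n by (simp add: field_simps)
        finally show ?thesis .
      qed
    next
      case True
      define d where "d = Suc (n - s n)"
      define P where "P = real (p n) - real (s n)"
      have P: "0 < P"
        using True by (simp add: P_def)
      have d: "real d = real n - real (s n) + 1"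
        using sn by (simp add: d_def of_nat_diff)
      have "real D \<le> (1 - \<gamma>') * real n"
        using elim \<gamma>' by (simp add: field_simps)
      then have "D \<le> d"
        using s\<gamma>' d by (simp add: algebra_simps)
      then have "\<rho> ^ d < \<delta> ^ d / 4"
        using D \<delta>0 by (simp add: power_divide field_simps)
      then have "\<delta> ^ d / 2 \<le> \<delta> ^ d - 2 * \<rho> ^ d"
        by simp
      then have "P * (\<delta> ^ d / 2) \<le> (P + 1) * (\<delta> ^ d - 2 * \<rho> ^ d)"
        using P \<delta>0 by (intro mult_mono) auto
      also have "\<dots> \<le> 2 * sqrt (1 + 2 * \<epsilon>) ^ d"
        using elim True by (simp add: P_def d_def \<rho>_def)
      finally have le: "P \<le> 4 * (sqrt (1 + 2 * \<epsilon>) / \<delta>) ^ d"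
        using \<delta>0 by (simp add: power_divide field_simps)
      have "ln P \<le> ln (4 * (sqrt (1 + 2 * \<epsilon>) / \<delta>) ^ d)"
        using P le by (intro ln_mono) auto
      also have "\<dots> = ln 4 + real d * (ln (1 + 2 * \<epsilon>) / 2 + ln (1 / \<delta>))"
        using \<delta>0 \<epsilon> by (simp add: ln_mult ln_realpow ln_div ln_sqrt)
      also have "\<dots> \<le> ln 4 + real d * K"
        using ln_add_one_self_le_self[of "2 * \<epsilon>"] \<epsilon>
        by (intro add_left_mono mult_left_mono) (auto simp: K_def)
      also have "\<dots> = ((ln 4 + K) / real n + K * (1 - real (s n) / real n)) * real n"
        using n by (simp add: d field_simps)
      also have "\<dots> \<le> C * real n"
        using elim n by (intro mult_right_mono) auto
      finally show ?thesis
        by (simp add: P_def)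
    qed
  qed
qed

theorem theorem4:
  fixes X :: "nat \<Rightarrow> real mat" and p s :: "nat \<Rightarrow> nat" and \<gamma> \<delta> \<delta>\<^sub>1 :: real
  assumes delta: "0 < 2 * \<delta>" "2 * \<delta> < 1"
    and delta1: "0 < \<delta>\<^sub>1" "\<delta>\<^sub>1 \<le> \<delta>"
    and gamma: "0 < \<gamma>" "\<gamma> < 1 / 2"
    and dims: "\<forall>\<^sub>F n in sequentially. X n \<in> carrier_mat n (p n)"
    and norms: "\<forall>\<^sub>F n in sequentially. \<forall>j<p n. sqrt (col (X n) j \<bullet> col (X n) j) = sqrt (real n)"
    and s_pos: "\<forall>\<^sub>F n in sequentially. 0 < s n"
    and s_spark: "\<forall>\<^sub>F n in sequentially. enat (2 * s n) < spark (X n)"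
    and s_lim: "(\<lambda>n. real (s n) / real n) \<longlonglongrightarrow> \<gamma>"
    and chordal: "\<forall>\<^sub>F n in sequentially.
      \<forall>V \<in> col_subspaces (X n) (s n). \<forall>W \<in> col_subspaces (X n) (s n).
        V \<noteq> W \<longrightarrow> 2 * \<delta> \<le> max_chordal_dist (s n) V W"
    and disjoint: "\<forall>\<^sub>F n in sequentially.
      \<forall>I J. I \<subseteq> {..<p n} \<and> J \<subseteq> {..<p n} \<and> card I = s n \<and> card J = s n \<and> I \<inter> J = {} \<longrightarrow>
        arcsin \<delta>\<^sub>1 \<le> min_principal_angle (s n) (col_span (X n) I) (col_span (X n) J)"
  shows "\<exists>r \<in> O(\<lambda>_. 1).
    (\<lambda>n. ln (real (p n) - real (s n))) \<lesssim>
    (\<lambda>n. (ln (1 / \<delta>) * (1 - \<gamma>) - c_const \<gamma> \<delta>\<^sub>1 - \<gamma> - 1 / 2 * ln (1 - 2 * \<gamma>)) * real n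
          + 2 * ln (real n) + r n)"
proof -
  define C where "C = ln (1 / \<delta>) * (1 - \<gamma>) - c_const \<gamma> \<delta>\<^sub>1 - \<gamma> - 1 / 2 * ln (1 - 2 * \<gamma>)"
  define L where "L = ln (1 / \<delta>)"
  have L: "0 < L"
    using delta by (simp add: L_def ln_gt_zero)
  have gap: "(1 - \<gamma>) * L < C"
    using c_const_slack[OF gamma delta1(1)] delta delta1 by (simp add: C_def L_def mult.commute)
  \<comment> \<open>Half of the gap keeps the perturbed exponent below \<open>C\<close>; the bound
    \<open>\<delta> / 2\<close> keeps the slab narrower than the ball.\<close>
  define \<epsilon> where "\<epsilon> = min (\<delta> / 2) ((C - (1 - \<gamma>) * L) / 2)"
  have \<epsilon>: "0 < \<epsilon>" "\<epsilon> < \<delta>" "2 * \<epsilon> \<le> C - (1 - \<gamma>) * L"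
    using delta gap by (auto simp: \<epsilon>_def min_def field_simps)
  have "(1 - \<gamma>) * \<epsilon> \<le> 1 * \<epsilon>"
    using gamma \<epsilon> by (intro mult_right_mono) auto
  then have C1: "(1 - \<gamma>) * (L + \<epsilon>) < C"
    unfolding distrib_left using \<epsilon>(1,3) by linarith
  \<comment> \<open>Positivity of \<open>C\<close> covers the case \<open>p n \<le> s n\<close>,
    where the packing gives nothing.\<close>
  have "0 < (1 - \<gamma>) * L"
    using L gamma by (intro mult_pos_pos) auto
  then have C0: "0 < C"
    using gap by simp
  have "\<forall>\<^sub>F n in sequentially. real (s n) / real n < 1 / 2"
    using s_lim gamma(2) by (rule order_tendstoD)
  then have pack: "\<forall>\<^sub>F n in sequentially. s n < p n \<longrightarrow> (real (p n) - real (s n) + 1) *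
      (\<delta> ^ Suc (n - s n) - 2 * sqrt (\<delta>\<^sup>2 - \<epsilon>\<^sup>2) ^ Suc (n - s n)) \<le> 2 * sqrt (1 + 2 * \<epsilon>) ^ Suc (n - s n)"
    using dims s_pos s_spark chordal eventually_gt_at_top[of 0]
  proof eventually_elim
    case (elim n)
    have "s n \<le> n"
      using elim by (simp add: field_simps)
    then show ?case
      using elim delta \<epsilon>(1,2) by (intro impI packing_of_column_lines[where A = "X n"]) auto
  qed
  \<comment> \<open>Since \<open>C\<close> is strictly larger than the packing exponent, the error terms can be taken to be \<open>0\<close>.\<close>
  have "\<forall>\<^sub>F n in sequentially. ln (real (p n) - real (s n)) \<le> C * real n"
    using \<epsilon> delta gamma C1 C0 pack s_lim
    by (intro eventually_ln_packing_bound[of \<epsilon> \<delta> \<gamma>]) (auto simp: L_def)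
  then have "\<forall>\<^sub>F n in sequentially. ln (real (p n) - real (s n)) \<le> (1 + 0) * (C * real n + 2 * ln (real n) + 0)"
    using eventually_ge_at_top[of 1]
  proof eventually_elim
    case (elim n)
    have "0 \<le> 2 * ln (real n)"
      using elim(2) by simp
    then show ?case
      unfolding add_0_right mult_1_left using elim(1) by linarith
  qed
  then show ?thesis
    unfolding asymp_dominated_def C_def[symmetric]
    by (intro bexI[of _ "\<lambda>_. 0"]) auto
qed

end
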